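(* Let $\mathcal D_{st}=(D,<_{st},\rho)$ and $\mathcal D_{wk}=(D,<_{wk},\rho)$ be two computable partially ordered sets on the same set $D$ such that $<_{st}$ extends $<_{wk}$ (i.e. $d<_{wk}e\Rightarrow d<_{st}e$). 1. Suppose condition $( * )$ holds: for every $k$ there exists a $<_{st}$-chain with $k$ elements which is a $<_{wk}$-antichain. Then $K^{\mathcal D_{st}}_{\max}<_{ct}K^{\mathcal D_{wk}}_{\max}$ and $K^{\mathcal D_{st}}_{\min}<_{ct}K^{\mathcal D_{wk}}_{\min}$. More strongly, for every total computable $\alpha:\mathbb N\to\mathbb N$ the sets $\{d\in D:\inf(K^{\mathcal D_{wk}}_{\min}(d),K^{\mathcal D_{wk}}_{\max}(d))\ge\alpha(K^{\mathcal D_{st}}_{\max}(d))\}$ and $\{d\in D:\inf(K^{\mathcal D_{wk}}_{\min}(d),K^{\mathcal D_{wk}}_{\max}(d))\ge\alpha(K^{\mathcal D_{st}}_{\min}(d))\}$ are infinite. 2. Suppose condition $( ** )$ holds: there exists $k$ such that for every partial computable $f:\{0,1\}^*\times\mathbb N\to D$ which is monotone increasing in its second argument with respect to $<_{st}$, there exist partial computable $f_1,\dots,f_k:\{0,1\}^*\times\mathbb N\to D$ monotone increasing in their second argument with respect to $<_{wk}$ such that for every $p$, $\{f(p,t):t\in\mathbb N\}=\bigcup_{i=1}^k\{f_i(p,t):t\in\mathbb N\}$ (sets of defined values). Then $K^{\mathcal D_{st}}_{\min}=_{ct}K^{\mathcal D_{wk}}_{\min}$ and $K^{\mathcal D_{st}}_{\max}=_{ct}K^{\mathcal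 D_{wk}}_{\max}$.
   Context: A computable partially ordered set is a triple $\mathcal D=(D,<,\rho)$ where $\rho:\mathbb N\to D$ is a bijection and $<$ is a strict partial order on $D$ with $\{(m,n):\rho(m)<\rho(n)\}$ computable; a partial function into $D$ is partial (resp. total) computable if its composition with $\rho^{-1}$ is. "Monotone increasing in the second argument" for a partial $f$ means monotone on its domain. For such $f:\{0,1\}^*\times\mathbb N\to D$, $\max^{\mathcal D}f$ is the partial function defined exactly at those $p$ for which $\{f(p,t):t\in\mathbb N,\ f(p,t)\text{ defined}\}$ is finite and non-empty, with value its maximum element. $\mathrm{Max}_{\mathrm{PR}}[\{0,1\}^*\to\mathcal D]$ is the class of all $\max^{\mathcal D}f$ with $f$ partial computable and monotone increasing in its second argument. For partial $\varphi:\{0,1\}^*\to D$, $K_\varphi(d)=\min\{|p|:\varphi(p)=d\}$. $K^{\mathcal D}_{\max}$ is $K_U$ for some $U\in\mathrm{Max}_{\mathrm{PR}}[\{0,1\}^*\to\mathcal D]$ optimal in that class (for every $F$ in the class there is $c$ with $K_U(d)\le K_F(d)+c$ whenever $K_F(d)$ is defined; such $U$ exists), and $K^{\mathcal D}_{\min}$ is $K^{\mathcal D'}_{\max}$ for the reverse order $\mathcal D'=(D,>,\rho)$; both are total functions $D\to\mathbb N$ defined up to an additive constant. $f\le_{ct}g$ iff $\exists c\,\forall d\ f(d)\le g(d)+c$; $f=_{ct}g$ iff both $f\le_{ct}g$ and $g\le_{ct}f$; $f<_{ct}g$ iff $f\le_{ct}g$ and not $g\le_{ct}f$. *)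

theory Defs
  imports Main
begin

datatype recf = Zr | Sc | Proj nat | Cn recf "recf list" | Pr recf recf | Mn recf

inductive eval :: "recf \<Rightarrow> nat list \<Rightarrow> nat \<Rightarrow> bool" where
  eval_Zr: "eval Zr xs 0"
| eval_Sc: "eval Sc (x # xs) (Suc x)"
| eval_Proj: "i < length xs \<Longrightarrow> eval (Proj i) xs (xs ! i)"
| eval_Cn: "list_all2 (\<lambda>g y. eval g xs y) gs ys \<Longrightarrow> eval f ys z \<Longrightarrow> eval (Cn f gs) xs z"
| eval_Pr0: "eval f xs y \<Longrightarrow> eval (Pr f g) (0 # xs) y"
| eval_PrS: "eval (Pr f g) (n # xs) y \<Longrightarrow> eval g (n # y # xs) z \<Longrightarrow> eval (Pr f g) (Suc n # xs) z"
| eval_Mn: "eval f (n # xs) 0 \<Longrightarrow> (\<forall>m<n. \<exists>y. eval f (m # xs) (Suc y)) \<Longrightarrow> eval (Mn f) xs n"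

definition pcomp1 :: "(nat \<Rightarrow> nat option) \<Rightarrow> bool" where
  "pcomp1 f \<longleftrightarrow> (\<exists>r. \<forall>x y. eval r [x] y \<longleftrightarrow> f x = Some y)"

definition pcomp2 :: "(nat \<Rightarrow> nat \<Rightarrow> nat option) \<Rightarrow> bool" where
  "pcomp2 f \<longleftrightarrow> (\<exists>r. \<forall>x t y. eval r [x, t] y \<longleftrightarrow> f x t = Some y)"

definition total_computable1 :: "(nat \<Rightarrow> nat) \<Rightarrow> bool" where
  "total_computable1 a \<longleftrightarrow> pcomp1 (\<lambda>x. Some (a x))"

definition total_computable2 :: "(nat \<Rightarrow> nat \<Rightarrow> nat) \<Rightarrow> bool" where
  "total_computable2 a \<longleftrightarrow> pcomp2 (\<lambda>x y. Some (a x y))"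

section \<open>Binary strings {0,1}* as bool lists, coded bijectively by naturals\<close>

fun bl_of_nat :: "nat \<Rightarrow> bool list" where
  "bl_of_nat 0 = []"
| "bl_of_nat (Suc n) = (if even n then False # bl_of_nat (n div 2) else True # bl_of_nat (n div 2))"

definition comp_poset :: "('d \<Rightarrow> 'd \<Rightarrow> bool) \<Rightarrow> (nat \<Rightarrow> 'd) \<Rightarrow> bool" where
  "comp_poset lt rho \<longleftrightarrow> bij rho \<and> (\<forall>x. \<not> lt x x) \<and>
     (\<forall>x y z. lt x y \<longrightarrow> lt y z \<longrightarrow> lt x z) \<and>
     total_computable2 (\<lambda>m n. if lt (rho m) (rho n) then 1 else 0)"

definition conv_ord :: "('d \<Rightarrow> 'd \<Rightarrow> bool) \<Rightarrow> 'd \<Rightarrow> 'd \<Rightarrow> bool" where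
  "conv_ord lt x y = lt y x"

definition comp_fn :: "(nat \<Rightarrow> 'd) \<Rightarrow> (bool list \<Rightarrow> nat \<Rightarrow> 'd option) \<Rightarrow> bool" where
  "comp_fn rho f \<longleftrightarrow> pcomp2 (\<lambda>n t. map_option (inv rho) (f (bl_of_nat n) t))"

definition mono2 :: "('d \<Rightarrow> 'd \<Rightarrow> bool) \<Rightarrow> (bool list \<Rightarrow> nat \<Rightarrow> 'd option) \<Rightarrow> bool" where
  "mono2 lt f \<longleftrightarrow> (\<forall>p s t y z. s \<le> t \<longrightarrow> f p s = Some y \<longrightarrow> f p t = Some z \<longrightarrow> y = z \<or> lt y z)"

definition values_of :: "(bool list \<Rightarrow> nat \<Rightarrow> 'd option) \<Rightarrow> bool list \<Rightarrow> 'd set" where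
  "values_of f p = {y. \<exists>t. f p t = Some y}"

definition is_max :: "('d \<Rightarrow> 'd \<Rightarrow> bool) \<Rightarrow> 'd set \<Rightarrow> 'd \<Rightarrow> bool" where
  "is_max lt S m \<longleftrightarrow> m \<in> S \<and> (\<forall>x\<in>S. x = m \<or> lt x m)"

definition maxD :: "('d \<Rightarrow> 'd \<Rightarrow> bool) \<Rightarrow> (bool list \<Rightarrow> nat \<Rightarrow> 'd option) \<Rightarrow> bool list \<Rightarrow> 'd option" where
  "maxD lt f p = (if finite (values_of f p) \<and> values_of f p \<noteq> {} \<and> (\<exists>m. is_max lt (values_of f p) m)
                  then Some (THE m. is_max lt (values_of f p) m) else None)"

definition MaxPR :: "('d \<Rightarrow> 'd \<Rightarrow> bool) \<Rightarrow> (nat \<Rightarrow> 'd) \<Rightarrow> (bool list \<Rightarrow> 'd option) set" where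
  "MaxPR lt rho = {maxD lt f | f. comp_fn rho f \<and> mono2 lt f}"

text \<open>K_phi(d) = min {|p| : phi p = d}; meaningful when d is in the range of phi.\<close>
definition KU :: "(bool list \<Rightarrow> 'd option) \<Rightarrow> 'd \<Rightarrow> nat" where
  "KU phi d = (LEAST n. \<exists>p. length p = n \<and> phi p = Some d)"

definition optimal_max :: "('d \<Rightarrow> 'd \<Rightarrow> bool) \<Rightarrow> (nat \<Rightarrow> 'd) \<Rightarrow> (bool list \<Rightarrow> 'd option) \<Rightarrow> bool" where
  "optimal_max lt rho U \<longleftrightarrow> U \<in> MaxPR lt rho \<and>
     (\<forall>F\<in>MaxPR lt rho. \<exists>c. \<forall>d. (\<exists>p. F p = Some d) \<longrightarrow>
        (\<exists>q. U q = Some d) \<and> KU U d \<le> KU F d + c)"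

definition le_ct :: "('d \<Rightarrow> nat) \<Rightarrow> ('d \<Rightarrow> nat) \<Rightarrow> bool" where
  "le_ct f g \<longleftrightarrow> (\<exists>c. \<forall>d. f d \<le> g d + c)"

definition eq_ct :: "('d \<Rightarrow> nat) \<Rightarrow> ('d \<Rightarrow> nat) \<Rightarrow> bool" where
  "eq_ct f g \<longleftrightarrow> le_ct f g \<and> le_ct g f"

definition lt_ct :: "('d \<Rightarrow> nat) \<Rightarrow> ('d \<Rightarrow> nat) \<Rightarrow> bool" where
  "lt_ct f g \<longleftrightarrow> le_ct f g \<and> \<not> le_ct g f"

definition cond_star :: "('d \<Rightarrow> 'd \<Rightarrow> bool) \<Rightarrow> ('d \<Rightarrow> 'd \<Rightarrow> bool) \<Rightarrow> bool" where
  "cond_star lst lwk \<longleftrightarrow> (\<forall>k::nat. \<exists>S. finite S \<and> card S = k \<and>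
      (\<forall>x\<in>S. \<forall>y\<in>S. x \<noteq> y \<longrightarrow> lst x y \<or> lst y x) \<and>
      (\<forall>x\<in>S. \<forall>y\<in>S. \<not> lwk x y))"

definition cond_2star :: "('d \<Rightarrow> 'd \<Rightarrow> bool) \<Rightarrow> ('d \<Rightarrow> 'd \<Rightarrow> bool) \<Rightarrow> (nat \<Rightarrow> 'd) \<Rightarrow> bool" where
  "cond_2star lst lwk rho \<longleftrightarrow> (\<exists>k::nat. \<forall>f. comp_fn rho f \<and> mono2 lst f \<longrightarrow>
      (\<exists>fs :: nat \<Rightarrow> bool list \<Rightarrow> nat \<Rightarrow> 'd option.
         (\<forall>i\<in>{1..k}. comp_fn rho (fs i) \<and> mono2 lwk (fs i)) \<and>
         (\<forall>p. values_of f p = (\<Union>i\<in>{1..k}. values_of (fs i) p))))"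

end

theory Submission
  imports Defs "HOL-Library.Nat_Bijection"
begin

text \<open>Part 1: on input \<open>n\<close>, find a long \<open><\<^bsub>st\<^esub>\<close>-chain which is a \<open><\<^bsub>wk\<^esub>\<close>-antichain and climb it, leaving
  an element whenever a program of length less than \<open>N(n)\<close> produces it in the \<open><\<^bsub>wk\<^esub>\<close>-increasing or in
  the \<open><\<^bsub>wk\<^esub>\<close>-decreasing sense. The values of one such program form a \<open><\<^bsub>wk\<^esub>\<close>-chain, so it meets the
  antichain at most once, and a long enough antichain keeps an element which is cheap for \<open><\<^bsub>st\<^esub>\<close> and
  expensive for \<open><\<^bsub>wk\<^esub>\<close>.

  Part 2: applying \<open>(**)\<close> to the increasing listing of a finite \<open><\<^bsub>st\<^esub>\<close>-chain shows that such a chain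
  contains no \<open><\<^bsub>wk\<^esub>\<close>-antichain with more than \<open>k\<close> elements. As \<open>(**)\<close> says nothing about decreasing
  functions, it is not used beyond this width bound, which is symmetric under reversing both orders.
  A \<open><\<^bsub>st\<^esub>\<close>-increasing enumeration of a set of \<open><\<^bsub>wk\<^esub>\<close>-width at most \<open>k\<close> presents each value after
  all those \<open><\<^bsub>wk\<^esub>\<close>-below it, and Felsner's on-line algorithm for up-growing orders splits it
  computably into at most \<open>k(k+1)/2\<close> enumerations increasing for \<open><\<^bsub>wk\<^esub>\<close>.\<close>

section \<open>Computable functions of an environment\<close>

text \<open>A function of countably many variables of which a program reads only the first \<open>k\<close>: with
  this encoding the closure rules need no arity bookkeeping.\<close>

definition computable :: "((nat \<Rightarrow> nat) \<Rightarrow> nat) \<Rightarrow> bool" where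
  "computable F \<longleftrightarrow> (\<exists>r k. \<forall>e y. eval r (map e [0..<k]) y \<longleftrightarrow> y = F e)"

definition decidable :: "((nat \<Rightarrow> nat) \<Rightarrow> bool) \<Rightarrow> bool" where
  "decidable P \<longleftrightarrow> computable (\<lambda>e. if P e then 1 else 0)"

section \<open>Inversion of the evaluation relation\<close>

inductive_cases eval_ZrE: "eval Zr xs y"
inductive_cases eval_ScE: "eval Sc xs y"
inductive_cases eval_ProjE: "eval (Proj i) xs y"
inductive_cases eval_CnE: "eval (Cn f gs) xs y"
inductive_cases eval_Pr0E: "eval (Pr f g) (0 # xs) y"
inductive_cases eval_PrSE: "eval (Pr f g) (Suc n # xs) y"
inductive_cases eval_MnE: "eval (Mn f) xs y"

lemma eval_Zr_iff: "eval Zr xs y \<longleftrightarrow> y = 0"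
  by (auto elim: eval_ZrE intro: eval.intros)

lemma eval_Sc_iff: "eval Sc (x # xs) y \<longleftrightarrow> y = Suc x"
  by (auto elim: eval_ScE intro: eval.intros)

lemma eval_Proj_iff: "eval (Proj i) xs y \<longleftrightarrow> i < length xs \<and> y = xs ! i"
  by (auto elim: eval_ProjE intro: eval.intros)

lemma eval_Cn_iff:
  "eval (Cn f gs) xs z \<longleftrightarrow> (\<exists>ys. list_all2 (\<lambda>g y. eval g xs y) gs ys \<and> eval f ys z)"
  by (auto elim: eval_CnE intro: eval.intros)

lemma eval_Pr0_iff: "eval (Pr f g) (0 # xs) y \<longleftrightarrow> eval f xs y"
  by (auto elim: eval_Pr0E intro: eval.intros)

lemma eval_PrS_iff:
  "eval (Pr f g) (Suc n # xs) z \<longleftrightarrow> (\<exists>y. eval (Pr f g) (n # xs) y \<and> eval g (n # y # xs) z)"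
  by (auto elim: eval_PrSE intro: eval.intros)

lemma eval_Mn_iff:
  "eval (Mn f) xs n \<longleftrightarrow> eval f (n # xs) 0 \<and> (\<forall>m<n. \<exists>y. eval f (m # xs) (Suc y))"
  by (auto elim: eval_MnE intro: eval.intros)

lemma list_all2_eq_map: "list_all2 (\<lambda>x y. y = f x) xs ys \<longleftrightarrow> ys = map f xs"
  by (induction xs arbitrary: ys) (auto simp: list_all2_Cons1)

lemma eval_Cn_total:
  assumes "\<And>g y. g \<in> set gs \<Longrightarrow> eval g xs y \<longleftrightarrow> y = v g"
  shows "eval (Cn f gs) xs z \<longleftrightarrow> eval f (map v gs) z"
proof -
  have "list_all2 (\<lambda>g y. eval g xs y) gs ys \<longleftrightarrow> list_all2 (\<lambda>g y. y = v g) gs ys" for ys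
    using assms by (intro list.rel_cong) auto
  then have "list_all2 (\<lambda>g y. eval g xs y) gs ys \<longleftrightarrow> ys = map v gs" for ys
    by (simp add: list_all2_eq_map)
  then show ?thesis by (simp add: eval_Cn_iff)
qed

text \<open>Composing with projections discards surplus inputs, so a program of arity
  \<open>k\<close> also works at every larger arity. This lets several programs share one
  arity.\<close>

lemma computableE:
  assumes "computable F"
  obtains r k where "\<And>m e y. k \<le> m \<Longrightarrow> eval r (map e [0..<m]) y \<longleftrightarrow> y = F e"
proof -
  obtain r k where r: "\<And>e y. eval r (map e [0..<k]) y \<longleftrightarrow> y = F e"
    using assms by (auto simp: computable_def)
  define v where "v e = (\<lambda>g. case g of Proj i \<Rightarrow> e i | _ \<Rightarrow> 0)" for e :: "nat \<Rightarrow> nat"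
  have "eval (Cn r (map Proj [0..<k])) (map e [0..<m]) y \<longleftrightarrow> y = F e" if "k \<le> m" for m e y
  proof -
    have "eval (Cn r (map Proj [0..<k])) (map e [0..<m]) y \<longleftrightarrow> eval r (map (v e) (map Proj [0..<k])) y"
      using that by (intro eval_Cn_total) (auto simp: eval_Proj_iff v_def)
    also have "map (v e) (map Proj [0..<k]) = map e [0..<k]"
      by (simp add: v_def)
    finally show ?thesis using r by simp
  qed
  then show thesis by (rule that)
qed

text \<open>Although infinitely many \<open>H i\<close> are substituted, \<open>G\<close> reads only
  its first \<open>k\<close> variables, so finitely many programs are composed. The sum
  \<open>m\<close> of their arities serves as a common one.\<close>

lemma computable_subst:
  assumes G: "computable G" and H: "\<And>i. computable (H i)"
  shows "computable (\<lambda>e. G (\<lambda>i. H i e))"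
proof -
  obtain r k where r: "\<And>e y. eval r (map e [0..<k]) y \<longleftrightarrow> y = G e"
    using G by (auto simp: computable_def)
  have "\<exists>q l. \<forall>m e y. l \<le> m \<longrightarrow> (eval q (map e [0..<m]) y \<longleftrightarrow> y = H i e)" for i
    using computableE[OF H[of i]] by metis
  then obtain q l where q: "\<And>i m e y. l i \<le> m \<Longrightarrow> eval (q i) (map e [0..<m]) y \<longleftrightarrow> y = H i e"
    by metis
  define m where "m = (\<Sum>i<k. l i)"
  have lm: "l i \<le> m" if "i < k" for i
    unfolding m_def using that by (intro member_le_sum) auto
  have "eval (Cn r (map q [0..<k])) (map e [0..<m]) y \<longleftrightarrow> y = G (\<lambda>i. H i e)" for e y
  proof -
    have "list_all2 (\<lambda>i y. eval (q i) (map e [0..<m]) y) [0..<k] ys \<longleftrightarrow>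
        list_all2 (\<lambda>i y. y = H i e) [0..<k] ys" for ys
      using q[OF lm] by (intro list.rel_cong) auto
    also have "\<dots> ys \<longleftrightarrow> ys = map (\<lambda>i. H i e) [0..<k]" for ys
      by (rule list_all2_eq_map)
    finally have "list_all2 (\<lambda>g y. eval g (map e [0..<m]) y) (map q [0..<k]) ys \<longleftrightarrow>
        ys = map (\<lambda>i. H i e) [0..<k]" for ys
      by (simp add: list_all2_map1)
    then show ?thesis using r by (simp add: eval_Cn_iff)
  qed
  then show ?thesis by (auto simp: computable_def)
qed

lemma computable_var [intro!]: "computable (\<lambda>e. e i)"
  unfolding computable_def
  by (rule exI[of _ "Proj i"], rule exI[of _ "Suc i"]) (auto simp: eval_Proj_iff simp del: upt_Suc)

lemma computable_shift: "computable G \<Longrightarrow> computable (\<lambda>e. G (\<lambda>i. e (Suc i)))"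
  by (rule computable_subst[of G "\<lambda>i e. e (Suc i)"]) auto

lemma computable_shift2: "computable G \<Longrightarrow> computable (\<lambda>e. G (\<lambda>i. e (Suc (Suc i))))"
  by (rule computable_subst[of G "\<lambda>i e. e (Suc (Suc i))"]) auto

text \<open>The value \<open>N e\<close> becomes variable 0 and the old variables move up by one.
  Rules with one bound variable are stated in this form: the body reads it at \<open>e 0\<close> and
  the outer variables at \<open>e (Suc i)\<close>.\<close>

lemma computable_bind:
  assumes "computable F" "computable N"
  shows "computable (\<lambda>e. F (case_nat (N e) e))"
proof -
  have "computable (\<lambda>e. F (\<lambda>i. (case i of 0 \<Rightarrow> N | Suc j \<Rightarrow> (\<lambda>e. e j)) e))"
    by (rule computable_subst[OF assms(1), of "case_nat N (\<lambda>j e. e j)"])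
      (auto simp: assms(2) split: nat.split)
  moreover have "(\<lambda>i. (case i of 0 \<Rightarrow> N | Suc j \<Rightarrow> (\<lambda>e. e j)) e) = case_nat (N e) e" for e
    by (auto split: nat.split)
  ultimately show ?thesis by simp
qed

lemma computable_let:
  assumes "computable (\<lambda>e. F (e 0) (\<lambda>i. e (Suc i)))" "computable N"
  shows "computable (\<lambda>e. F (N e) e)"
  using computable_bind[OF assms] by simp

lemma computable_app2:
  assumes f: "computable (\<lambda>e. f (e 0) (e 1))" and "computable G" "computable H"
  shows "computable (\<lambda>e. f (G e) (H e))"
  using computable_subst[OF f, of "\<lambda>i. if i = 0 then G else H"] assms by simp

lemma computable_app1:
  assumes f: "computable (\<lambda>e. f (e 0))" and "computable G"
  shows "computable (\<lambda>e. f (G e))"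
  using computable_subst[OF f, of "\<lambda>i. G"] assms by simp

lemma computable_app3:
  assumes f: "computable (\<lambda>e. f (e 0) (e 1) (e 2))" and "computable G" "computable H" "computable K"
  shows "computable (\<lambda>e. f (G e) (H e) (K e))"
  using computable_subst[OF f, of "\<lambda>i. if i = 0 then G else if i = 1 then H else K"] assms by simp

lemma computable_Suc [intro]:
  assumes "computable F" shows "computable (\<lambda>e. Suc (F e))"
proof -
  have "computable (\<lambda>e. Suc (e 0))"
    unfolding computable_def
    by (rule exI[of _ Sc], rule exI[of _ 1]) (auto simp: eval_Sc_iff)
  from computable_app1[OF this assms] show ?thesis .
qed

lemma computable_const [intro!]: "computable (\<lambda>e. c)"
proof (induction c)
  case 0
  show ?case unfolding computable_def
    by (rule exI[of _ Zr], rule exI[of _ 0]) (auto simp: eval_Zr_iff)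
qed auto

lemma map_case_nat_upt: "map (case_nat n e) [0..<Suc k] = n # map e [0..<k]"
  by (auto simp: upt_conv_Cons map_Suc_upt[symmetric] simp del: upt_Suc map_Suc_upt)

text \<open>\<open>Pr\<close> puts the counter and the previous value in front of the parameters, so
  in the hypothesis on \<open>S\<close> they are the variables 0 and 1.\<close>

lemma computable_rec_nat:
  assumes N: "computable N" and B: "computable B"
    and S: "computable (\<lambda>e. S (e 0) (e 1) (\<lambda>i. e (Suc (Suc i))))"
  shows "computable (\<lambda>e. rec_nat (B e) (\<lambda>m y. S m y e) (N e))"
proof -
  obtain rb kb where rb: "\<And>m e y. kb \<le> m \<Longrightarrow> eval rb (map e [0..<m]) y \<longleftrightarrow> y = B e"
    by (rule computableE[OF B]) blast
  obtain rs ks where rs: "\<And>m e y. ks \<le> m \<Longrightarrow> eval rs (map e [0..<m]) y \<longleftrightarrow>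
      y = S (e 0) (e 1) (\<lambda>i. e (Suc (Suc i)))"
    by (rule computableE[OF S]) blast
  define k where "k = max kb ks"
  have step: "eval rs (m # x # map e [0..<k]) y \<longleftrightarrow> y = S m x e" for m x e y
    using rs[of "Suc (Suc k)" "case_nat m (case_nat x e)" y]
    by (simp add: map_case_nat_upt k_def del: upt_Suc)
  have main: "eval (Pr rb rs) (n # map e [0..<k]) y \<longleftrightarrow> y = rec_nat (B e) (\<lambda>m y. S m y e) n" for n e y
    by (induction n arbitrary: y) (simp_all add: eval_Pr0_iff eval_PrS_iff rb k_def step[unfolded k_def])
  have "computable (\<lambda>e. rec_nat (B (\<lambda>i. e (Suc i))) (\<lambda>m y. S m y (\<lambda>i. e (Suc i))) (e 0))"
    unfolding computable_def
  proof (intro exI allI)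
    fix e :: "nat \<Rightarrow> nat" and y
    have "map e [0..<Suc k] = e 0 # map (\<lambda>i. e (Suc i)) [0..<k]"
      by (simp add: upt_conv_Cons map_Suc_upt[symmetric] del: upt_Suc map_Suc_upt)
    then show "eval (Pr rb rs) (map e [0..<Suc k]) y \<longleftrightarrow>
        y = rec_nat (B (\<lambda>i. e (Suc i))) (\<lambda>m y. S m y (\<lambda>i. e (Suc i))) (e 0)"
      using main by simp
  qed
  from computable_bind[OF this N] show ?thesis by simp
qed

text \<open>\<open>Mn\<close> looks for the value 0 and requires positive values before it, so it is
  applied to the negated characteristic function. The assumption \<open>ex\<close> makes the search
  succeed in every environment.\<close>

lemma computable_Least:
  assumes P: "decidable (\<lambda>e. P (e 0) (\<lambda>i. e (Suc i)))" and ex: "\<And>e. \<exists>n. P n e"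
  shows "computable (\<lambda>e. LEAST n. P n e)"
proof -
  \<comment> \<open>Recursion from 1 with constant step 0 swaps the truth values 0 and 1.\<close>
  have "computable (\<lambda>e. rec_nat 1 (\<lambda>_ _. 0) (if P (e 0) (\<lambda>i. e (Suc i)) then 1 else 0))"
    using P unfolding decidable_def by (intro computable_rec_nat) auto
  also have "(\<lambda>e. rec_nat 1 (\<lambda>_ _. 0::nat) (if P (e 0) (\<lambda>i. e (Suc i)) then 1 else 0)) =
      (\<lambda>e. if P (e 0) (\<lambda>i. e (Suc i)) then 0 else 1)"
    by auto
  finally have c: "computable (\<lambda>e. if P (e 0) (\<lambda>i. e (Suc i)) then 0 else 1)" .
  obtain r k where r: "\<And>m e y. k \<le> m \<Longrightarrow> eval r (map e [0..<m]) y \<longleftrightarrow>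
      y = (if P (e 0) (\<lambda>i. e (Suc i)) then 0 else 1)"
    by (rule computableE[OF c]) blast
  have r': "eval r (n # map e [0..<k]) y \<longleftrightarrow> y = (if P n e then 0 else 1)" for n e y
    using r[of "Suc k" "case_nat n e" y] by (simp add: map_case_nat_upt del: upt_Suc)
  have "eval (Mn r) (map e [0..<k]) y \<longleftrightarrow> y = (LEAST n. P n e)" for e y
  proof -
    have "eval (Mn r) (map e [0..<k]) y \<longleftrightarrow> P y e \<and> (\<forall>m<y. \<not> P m e)"
      by (auto simp: eval_Mn_iff r')
    also have "\<dots> \<longleftrightarrow> y = (LEAST n. P n e)"
      using LeastI_ex[OF ex[of e]] not_less_Least[of _ "\<lambda>n. P n e"]
      by (metis Least_equality linorder_not_le)
    finally show ?thesis .
  qed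
  then show ?thesis by (auto simp: computable_def)
qed

section \<open>Arithmetic, connectives and bounded quantifiers\<close>

lemma computable_add:
  assumes "computable F" "computable G" shows "computable (\<lambda>e. F e + G e)"
proof -
  have *: "rec_nat a (\<lambda>_ y. Suc y) b = a + b" for a b by (induction b) auto
  have "computable (\<lambda>e. rec_nat (F e) (\<lambda>_ y. Suc y) (G e))"
    using assms by (intro computable_rec_nat) auto
  then show ?thesis by (simp add: *)
qed

lemma computable_mult:
  assumes "computable F" "computable G" shows "computable (\<lambda>e. F e * G e)"
proof -
  have *: "rec_nat 0 (\<lambda>_ y. y + a) b = a * b" for a b :: nat by (induction b) auto
  have "computable (\<lambda>e. rec_nat 0 (\<lambda>_ y. y + F e) (G e))"
    using assms by (intro computable_rec_nat computable_add computable_shift2[OF assms(1)]) auto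
  then show ?thesis by (simp add: *)
qed

lemma computable_power:
  assumes "computable F" "computable G" shows "computable (\<lambda>e. F e ^ G e)"
proof -
  have *: "rec_nat 1 (\<lambda>_ y. y * a) b = a ^ b" for a b :: nat by (induction b) auto
  have "computable (\<lambda>e. rec_nat 1 (\<lambda>_ y. y * F e) (G e))"
    using assms by (intro computable_rec_nat computable_mult computable_shift2[OF assms(1)]) auto
  then show ?thesis by (simp only: *)
qed

lemma computable_diff:
  assumes "computable F" "computable G" shows "computable (\<lambda>e. F e - G e)"
proof -
  have p: "rec_nat 0 (\<lambda>m _. m) a = a - 1" for a :: nat by (induction a) auto
  have "computable (\<lambda>e. rec_nat 0 (\<lambda>m _. m) (e 0))"
    by (intro computable_rec_nat) auto
  then have pred: "computable (\<lambda>e. e 0 - 1)" by (simp add: p)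
  have *: "rec_nat a (\<lambda>_ y. y - 1) b = a - b" for a b :: nat by (induction b) auto
  have "computable (\<lambda>e. rec_nat (F e) (\<lambda>_ y. y - 1) (G e))"
    using assms by (intro computable_rec_nat computable_app1[of "\<lambda>x. x - 1", OF pred]) auto
  then show ?thesis by (simp only: *)
qed

lemma computable_if:
  assumes "decidable P" "computable F" "computable G"
  shows "computable (\<lambda>e. if P e then F e else G e)"
proof -
  have "computable (\<lambda>e. F e * (if P e then 1 else 0) + G e * (1 - (if P e then 1 else 0)))"
    using assms unfolding decidable_def by (intro computable_add computable_mult computable_diff computable_const)
  also have "(\<lambda>e. F e * (if P e then 1 else 0) + G e * (1 - (if P e then 1 else 0))) =
      (\<lambda>e. if P e then F e else G e)" by auto
  finally show ?thesis .
qed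

lemma decidable_not:
  assumes "decidable P" shows "decidable (\<lambda>e. \<not> P e)"
proof -
  have "computable (\<lambda>e. if P e then 0 else 1)"
    using assms by (intro computable_if computable_const)
  moreover have "(\<lambda>e. if P e then 0 else 1::nat) = (\<lambda>e. if \<not> P e then 1 else 0)" by auto
  ultimately show ?thesis unfolding decidable_def by simp
qed

lemma decidable_conj:
  assumes "decidable P" "decidable Q" shows "decidable (\<lambda>e. P e \<and> Q e)"
proof -
  have "computable (\<lambda>e. if P e then if Q e then 1 else 0 else 0)"
    using assms by (intro computable_if computable_const)
  moreover have "(\<lambda>e. if P e then if Q e then 1 else 0 else 0::nat) = (\<lambda>e. if P e \<and> Q e then 1 else 0)"
    by auto
  ultimately show ?thesis unfolding decidable_def by simp
qed

lemma decidable_disj: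
  assumes "decidable P" "decidable Q" shows "decidable (\<lambda>e. P e \<or> Q e)"
  using decidable_not[OF decidable_conj[OF decidable_not[OF assms(1)] decidable_not[OF assms(2)]]] by simp

lemma decidable_imp:
  assumes "decidable P" "decidable Q" shows "decidable (\<lambda>e. P e \<longrightarrow> Q e)"
  using decidable_disj[OF decidable_not[OF assms(1)] assms(2)] by (simp only: imp_conv_disj)

lemma decidable_le:
  assumes "computable F" "computable G" shows "decidable (\<lambda>e. F e \<le> G e)"
proof -
  have "computable (\<lambda>e. rec_nat 1 (\<lambda>_ _. 0) (F e - G e))"
    using assms by (intro computable_rec_nat computable_diff computable_const)
  moreover have "rec_nat 1 (\<lambda>_ _. 0::nat) (a - b) = (if a \<le> b then 1 else 0)" for a b :: nat
    by (cases "a - b") auto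
  ultimately show ?thesis by (simp add: decidable_def)
qed

lemma decidable_less:
  assumes "computable F" "computable G" shows "decidable (\<lambda>e. F e < G e)"
  using decidable_le[OF computable_Suc[OF assms(1)] assms(2)] by (simp add: Suc_le_eq)

lemma decidable_eq:
  assumes "computable F" "computable G" shows "decidable (\<lambda>e. F e = G e)"
  using decidable_conj[OF decidable_le[OF assms] decidable_le[OF assms(2,1)]] by (simp add: eq_iff)

text \<open>The extra disjunct \<open>n \<ge> N e\<close> makes the search stop; it stops below
  \<open>N e\<close> exactly when there is a witness.\<close>

lemma decidable_bex:
  assumes N: "computable N" and P: "decidable (\<lambda>e. P (e 0) (\<lambda>i. e (Suc i)))"
  shows "decidable (\<lambda>e. \<exists>n<N e. P n e)"
proof -
  have "decidable (\<lambda>e. (LEAST n. n \<ge> N e \<or> P n e) < N e)"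
    using N by (intro decidable_less computable_Least decidable_disj decidable_le P computable_shift[OF N]) auto
  moreover have "(LEAST n. n \<ge> N e \<or> P n e) < N e \<longleftrightarrow> (\<exists>n<N e. P n e)" for e
  proof
    assume l: "(LEAST n. n \<ge> N e \<or> P n e) < N e"
    have "(LEAST n. n \<ge> N e \<or> P n e) \<ge> N e \<or> P (LEAST n. n \<ge> N e \<or> P n e) e"
      by (rule LeastI[of "\<lambda>n. n \<ge> N e \<or> P n e" "N e"]) simp
    with l show "\<exists>n<N e. P n e" by auto
  next
    assume "\<exists>n<N e. P n e"
    then show "(LEAST n. n \<ge> N e \<or> P n e) < N e"
      using Least_le[of "\<lambda>n. n \<ge> N e \<or> P n e"] le_less_trans by blast
  qed
  ultimately show ?thesis by simp
qed

lemma decidable_ball: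
  assumes N: "computable N" and P: "decidable (\<lambda>e. P (e 0) (\<lambda>i. e (Suc i)))"
  shows "decidable (\<lambda>e. \<forall>n<N e. P n e)"
  using decidable_not[OF decidable_bex[OF N decidable_not[OF P]]] by simp

lemma computable_sum:
  assumes N: "computable N" and F: "computable (\<lambda>e. F (e 0) (\<lambda>i. e (Suc i)))"
  shows "computable (\<lambda>e. \<Sum>n<N e. F n e)"
proof -
  have *: "rec_nat 0 (\<lambda>n y. y + F n e) b = (\<Sum>n<b. F n e)" for b e by (induction b) auto
  have F': "computable (\<lambda>e. F (e 0) (\<lambda>i. e (Suc (Suc i))))"
    using computable_subst[OF F, of "\<lambda>i e. e (if i = 0 then 0 else Suc i)"] computable_var by simp
  have "computable (\<lambda>e. rec_nat 0 (\<lambda>n y. y + F n e) (N e))"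
    using N F' by (intro computable_rec_nat computable_add) auto
  then show ?thesis by (simp add: *)
qed

lemma computable_div:
  assumes "computable F" "computable G" shows "computable (\<lambda>e. F e div G e)"
proof -
  have ex: "a < Suc a * b" if "b \<noteq> 0" for a b :: nat
    using that by (cases b) auto
  have *: "(LEAST q. b = 0 \<or> a < Suc q * b) = a div b" for a b :: nat
  proof (cases "b = 0")
    case False
    show ?thesis
    proof (rule Least_equality)
      show "b = 0 \<or> a < Suc (a div b) * b"
        using False by (simp add: dividend_less_div_times)
    next
      fix q assume "b = 0 \<or> a < Suc q * b"
      with False have "a div b < Suc q" by (simp add: less_mult_imp_div_less)
      then show "a div b \<le> q" by simp
    qed
  qed auto
  have "computable (\<lambda>e. LEAST q. G e = 0 \<or> F e < Suc q * G e)"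
    using assms ex
    by (intro computable_Least decidable_disj decidable_eq decidable_less computable_mult
        computable_shift[OF assms(1)] computable_shift[OF assms(2)]) auto
  then show ?thesis by (simp only: *)
qed

lemma computable_mod:
  assumes "computable F" "computable G" shows "computable (\<lambda>e. F e mod G e)"
  using computable_diff[OF assms(1) computable_mult[OF computable_div[OF assms] assms(2)]]
  by (simp add: modulo_nat_def)

lemma decidable_set_decode:
  assumes "computable F" "computable G" shows "decidable (\<lambda>e. F e \<in> set_decode (G e))"
proof -
  have "decidable (\<lambda>e. (G e div 2 ^ F e) mod 2 = 1)"
    using assms by (intro decidable_eq computable_mod computable_div computable_power computable_const)
  moreover have "(\<lambda>e. (G e div 2 ^ F e) mod 2 = 1) = (\<lambda>e. F e \<in> set_decode (G e))"
    by (auto simp: set_decode_def odd_iff_mod_2_eq_one)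
  ultimately show ?thesis by simp
qed

lemmas computable_intros =
  computable_var computable_const computable_Suc computable_add computable_mult computable_power
  computable_diff computable_if computable_sum computable_div computable_mod computable_rec_nat
  decidable_not decidable_conj decidable_disj decidable_imp decidable_le decidable_less decidable_eq
  decidable_bex decidable_ball decidable_set_decode

section \<open>Evaluation with fuel\<close>

text \<open>The fuel only bounds the range of the unbounded searches.\<close>

fun eval_fuel :: "recf \<Rightarrow> nat \<Rightarrow> nat list \<Rightarrow> nat" where
  "eval_fuel Zr s xs = 1"
| "eval_fuel Sc s xs = (case xs of [] \<Rightarrow> 0 | x # _ \<Rightarrow> Suc (Suc x))"
| "eval_fuel (Proj i) s xs = (if i < length xs then Suc (xs ! i) else 0)"
| "eval_fuel (Cn f gs) s xs =
    (if \<forall>g\<in>set gs. eval_fuel g s xs \<noteq> 0 then eval_fuel f s (map (\<lambda>g. eval_fuel g s xs - 1) gs) else 0)"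
| "eval_fuel (Pr f g) s xs = (case xs of [] \<Rightarrow> 0 | n # ys \<Rightarrow>
    rec_nat (eval_fuel f s ys) (\<lambda>m y. if y = 0 then 0 else eval_fuel g s (m # (y - 1) # ys)) n)"
| "eval_fuel (Mn f) s xs =
    (let m = (LEAST m. m \<ge> s \<or> eval_fuel f s (m # xs) \<le> 1)
     in if m < s \<and> eval_fuel f s (m # xs) = 1 then Suc m else 0)"

text \<open>\<open>eval_fuel\<close> returns 0 for no result and \<open>Suc y\<close> for the result
  \<open>y\<close>, so the value 1 is a zero of \<open>f\<close> while 0 is a failure. The search
  stops at either, and only a zero counts.\<close>

lemma eval_fuel_Mn:
  "eval_fuel (Mn f) s xs = Suc m \<longleftrightarrow>
    m < s \<and> eval_fuel f s (m # xs) = 1 \<and> (\<forall>i<m. \<exists>y. eval_fuel f s (i # xs) = Suc (Suc y))"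
  (is "?l \<longleftrightarrow> ?r")
proof
  assume ?l
  define P where "P m \<longleftrightarrow> m \<ge> s \<or> eval_fuel f s (m # xs) \<le> 1" for m
  from \<open>?l\<close> have m: "m = (LEAST m. P m)" "m < s" "eval_fuel f s (m # xs) = 1"
    by (auto simp: Let_def P_def split: if_splits)
  have "\<not> P i" if "i < m" for i
    using that not_less_Least m(1) by blast
  then have "eval_fuel f s (i # xs) > 1" if "i < m" for i
    using that by (auto simp: P_def not_le)
  then have "\<exists>y. eval_fuel f s (i # xs) = Suc (Suc y)" if "i < m" for i
    using that by (intro exI[of _ "eval_fuel f s (i # xs) - 2"]) fastforce
  then show ?r using m by blast
next
  assume r: ?r
  have "(LEAST m. m \<ge> s \<or> eval_fuel f s (m # xs) \<le> 1) = m"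
  proof (rule Least_equality)
    fix i assume "i \<ge> s \<or> eval_fuel f s (i # xs) \<le> 1"
    with r have "\<not> i < m" by force
    then show "m \<le> i" by simp
  qed (use r in simp)
  then show ?l using r by simp
qed

declare eval_fuel.simps(6) [simp del]

text \<open>More fuel only turns failures into results. For \<open>Mn\<close>, all arguments before
  the zero have already converged to positive values, so the longer search finds the same
  zero.\<close>

lemma eval_fuel_mono:
  "eval_fuel r s xs = Suc y \<Longrightarrow> s \<le> s' \<Longrightarrow> eval_fuel r s' xs = Suc y"
proof (induction r arbitrary: xs y)
  case (Cn f gs)
  have nz: "\<forall>g\<in>set gs. eval_fuel g s xs \<noteq> 0"
    and f: "eval_fuel f s (map (\<lambda>g. eval_fuel g s xs - 1) gs) = Suc y"
    using Cn.prems(1) by (auto split: if_splits)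
  have eq: "eval_fuel g s' xs = eval_fuel g s xs" if "g \<in> set gs" for g
    using Cn.IH(2)[OF that _ Cn.prems(2)] nz that by (metis not0_implies_Suc)
  then have "map (\<lambda>g. eval_fuel g s' xs - 1) gs = map (\<lambda>g. eval_fuel g s xs - 1) gs"
    by simp
  then show ?case using Cn.IH(1)[OF f Cn.prems(2)] nz eq by (simp del: map_eq_conv)
next
  case (Pr f g)
  obtain n ys where xs: "xs = n # ys" using Pr.prems by (auto split: list.splits)
  have "eval_fuel (Pr f g) s (n # ys) = Suc y \<Longrightarrow> eval_fuel (Pr f g) s' (n # ys) = Suc y" for n y
  proof (induction n arbitrary: y)
    case 0
    then show ?case using Pr.IH(1) Pr.prems(2) by simp
  next
    case (Suc n)
    define v where "v s = eval_fuel (Pr f g) s (n # ys)" for s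
    have rec: "eval_fuel (Pr f g) s (Suc n # ys) = (if v s = 0 then 0 else eval_fuel g s (n # (v s - 1) # ys))" for s
      by (simp add: v_def)
    from Suc.prems obtain w where "v s = Suc w" "eval_fuel g s (n # w # ys) = Suc y"
      unfolding rec by (cases "v s") auto
    with Suc.IH[of w] show ?case
      unfolding rec v_def[symmetric] using Pr.IH(2)[OF _ Pr.prems(2)] by simp
  qed
  then show ?case using Pr.prems(1) xs by simp
next
  case (Mn f)
  show ?case
    using Mn.prems unfolding eval_fuel_Mn by (metis Mn.IH One_nat_def order_less_le_trans)
qed (auto split: list.splits if_splits)

lemma eval_fuel_sound: "eval_fuel r s xs = Suc y \<Longrightarrow> eval r xs y"
proof (induction r arbitrary: xs y)
  case (Cn f gs)
  have nz: "\<forall>g\<in>set gs. eval_fuel g s xs \<noteq> 0"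
    and f: "eval_fuel f s (map (\<lambda>g. eval_fuel g s xs - 1) gs) = Suc y"
    using Cn.prems by (auto split: if_splits)
  have "list_all2 (\<lambda>g y. eval g xs y) gs (map (\<lambda>g. eval_fuel g s xs - 1) gs)"
    using Cn.IH(2) nz by (auto simp: list_all2_map2 intro!: list.rel_refl_strong)
  then show ?case using Cn.IH(1)[OF f] by (auto intro: eval_Cn)
next
  case (Pr f g)
  obtain n ys where xs: "xs = n # ys" using Pr.prems by (auto split: list.splits)
  have "eval_fuel (Pr f g) s (n # ys) = Suc y \<Longrightarrow> eval (Pr f g) (n # ys) y" for n y
  proof (induction n arbitrary: y)
    case 0
    then show ?case using Pr.IH(1) by (simp add: eval_Pr0_iff)
  next
    case (Suc n)
    define v where "v = eval_fuel (Pr f g) s (n # ys)"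
    from Suc.prems obtain w where "v = Suc w" "eval_fuel g s (n # w # ys) = Suc y"
      by (cases v) (auto simp: v_def split: if_splits)
    with Suc.IH[of w] Pr.IH(2) show ?case
      unfolding eval_PrS_iff v_def by blast
  qed
  then show ?case using Pr.prems xs by simp
next
  case (Mn f)
  have "eval_fuel f s (y # xs) = Suc 0" "\<forall>i<y. \<exists>z. eval_fuel f s (i # xs) = Suc (Suc z)"
    using Mn.prems unfolding eval_fuel_Mn by auto
  then show ?case using Mn.IH by (intro eval_Mn) blast+
qed (auto split: list.splits if_splits intro: eval.intros)

lemma eval_fuel_complete: "eval r xs y \<Longrightarrow> \<exists>s. eval_fuel r s xs = Suc y"
proof (induction rule: eval.induct)
  case (eval_Cn xs gs ys f z)
  have "\<exists>s. list_all2 (\<lambda>g y. eval_fuel g s xs = Suc y) gs ys"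
    using eval_Cn.IH(1)
  proof (induction rule: list_all2_induct)
    case (Cons g gs y ys)
    then obtain s1 s2 where "eval_fuel g s1 xs = Suc y"
      and l: "list_all2 (\<lambda>g y. eval_fuel g s2 xs = Suc y) gs ys" by blast
    then have "eval_fuel g (max s1 s2) xs = Suc y" by (auto intro: eval_fuel_mono)
    moreover have "list_all2 (\<lambda>g y. eval_fuel g (max s1 s2) xs = Suc y) gs ys"
      using l by (rule list_all2_mono) (auto intro: eval_fuel_mono)
    ultimately show ?case by blast
  qed auto
  then obtain s1 where s1: "list_all2 (\<lambda>g y. eval_fuel g s1 xs = Suc y) gs ys" by blast
  obtain s2 where s2: "eval_fuel f s2 ys = Suc z" using eval_Cn.IH(2) by blast
  define s where "s = max s1 s2"
  have l: "list_all2 (\<lambda>g y. eval_fuel g s xs = Suc y) gs ys"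
    using s1 by (rule list_all2_mono) (auto simp: s_def intro: eval_fuel_mono)
  then have "\<forall>g\<in>set gs. eval_fuel g s xs \<noteq> 0"
    by (induction rule: list_all2_induct) auto
  moreover have "map (\<lambda>g. eval_fuel g s xs - 1) gs = ys"
    using l by (induction rule: list_all2_induct) auto
  moreover have "eval_fuel f s ys = Suc z"
    using s2 by (auto simp: s_def intro: eval_fuel_mono)
  ultimately show ?case by (intro exI[of _ s]) simp
next
  case (eval_PrS f g n xs y z)
  then obtain s1 s2 where s1: "eval_fuel (Pr f g) s1 (n # xs) = Suc y"
    and s2: "eval_fuel g s2 (n # y # xs) = Suc z" by blast
  have "eval_fuel (Pr f g) (max s1 s2) (n # xs) = Suc y" "eval_fuel g (max s1 s2) (n # y # xs) = Suc z"
    using eval_fuel_mono[OF s1] eval_fuel_mono[OF s2] by auto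
  then show ?case by (intro exI[of _ "max s1 s2"]) simp
next
  case (eval_Mn f n xs)
  then obtain s0 where s0: "eval_fuel f s0 (n # xs) = Suc 0" by blast
  have "\<forall>m<n. \<exists>y s. eval_fuel f s (m # xs) = Suc (Suc y)" using eval_Mn by blast
  then obtain y s where ys: "\<And>m. m < n \<Longrightarrow> eval_fuel f (s m) (m # xs) = Suc (Suc (y m))" by metis
  \<comment> \<open>Above the fuel needed for every argument up to \<open>n\<close>, and above
    \<open>n\<close> itself, since the fuel also bounds the range of the search.\<close>
  define u where "u = s0 + (\<Sum>m<n. s m) + Suc n"
  have "s m \<le> u" if "m < n" for m
  proof -
    have "s m \<le> (\<Sum>m<n. s m)" using that by (intro member_le_sum) auto
    then show ?thesis by (simp add: u_def)
  qed
  then have "eval_fuel f u (m # xs) = Suc (Suc (y m))" if "m < n" for m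
    using eval_fuel_mono[OF ys] that by blast
  moreover have "eval_fuel f u (n # xs) = Suc 0"
    using eval_fuel_mono[OF s0] by (simp add: u_def)
  ultimately have "eval_fuel (Mn f) u xs = Suc n"
    unfolding eval_fuel_Mn by (auto simp: u_def)
  then show ?case by blast
qed auto

lemma decidable_list_all:
  "(\<And>g. g \<in> set gs \<Longrightarrow> decidable (P g)) \<Longrightarrow> decidable (\<lambda>e. \<forall>g\<in>set gs. P g e)"
proof (induction gs)
  case Nil
  then show ?case by (simp add: decidable_def computable_const)
qed (simp add: decidable_conj)

text \<open>Structural induction on the fixed program \<open>r\<close>. The arguments are arbitrary
  computable functions of the environment because \<open>Pr\<close> and \<open>Mn\<close> evaluate
  their bodies under additional bound variables.\<close>

lemma computable_eval_fuel:
  "computable S \<Longrightarrow> (\<And>G. G \<in> set Gs \<Longrightarrow> computable G) \<Longrightarrow>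
    computable (\<lambda>e. eval_fuel r (S e) (map (\<lambda>G. G e) Gs))"
proof (induction r arbitrary: S Gs)
  case Zr
  show ?case by (simp add: computable_const)
next
  case Sc
  then show ?case by (cases Gs) (auto intro!: computable_Suc computable_const)
next
  case (Proj i)
  show ?case
  proof (cases "i < length Gs")
    case True
    then show ?thesis using Proj.prems(2)[of "Gs ! i"] by (simp add: computable_Suc)
  qed (simp add: computable_const)
next
  case (Cn f gs)
  define H where "H g = (\<lambda>e. eval_fuel g (S e) (map (\<lambda>G. G e) Gs))" for g
  have H: "computable (H g)" if "g \<in> set gs" for g
    unfolding H_def using Cn.IH(2)[OF that Cn.prems] .
  have "computable (\<lambda>e. eval_fuel f (S e) (map (\<lambda>G. G e) (map (\<lambda>g e. H g e - 1) gs)))"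
    using H by (intro Cn.IH(1) Cn.prems(1)) (auto intro!: computable_diff computable_const)
  then have "computable (\<lambda>e. eval_fuel f (S e) (map (\<lambda>g. H g e - 1) gs))"
    by (simp add: comp_def)
  moreover have "decidable (\<lambda>e. \<forall>g\<in>set gs. H g e \<noteq> 0)"
    using H by (intro decidable_list_all decidable_not decidable_eq computable_const)
  ultimately have "computable (\<lambda>e. if \<forall>g\<in>set gs. H g e \<noteq> 0
      then eval_fuel f (S e) (map (\<lambda>g. H g e - 1) gs) else 0)"
    by (intro computable_if computable_const)
  then show ?case by (simp only: eval_fuel.simps H_def)
next
  case (Pr f g)
  show ?case
  proof (cases Gs)
    case Nil
    then show ?thesis by (simp add: computable_const)
  next
    case (Cons N Ys)
    have Ys: "computable G" if "G \<in> set Ys" for G using Pr.prems(2) that Cons by simp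
    \<comment> \<open>Variables 0 and 1 are the counter and the previous result; the latter carries
      the offset of \<open>eval_fuel\<close>, hence the \<open>- 1\<close>.\<close>
    define Zs where "Zs = (\<lambda>e. e 0) # (\<lambda>e. e 1 - 1) # map (\<lambda>G e. G (\<lambda>i. e (Suc (Suc i)))) Ys"
    have Zs: "computable G" if "G \<in> set Zs" for G
      using that Ys unfolding Zs_def
      by (auto intro: computable_shift2 computable_diff[OF computable_var computable_const, of 1 1, simplified]
          computable_var)
    have "computable (\<lambda>e. eval_fuel g (S (\<lambda>i. e (Suc (Suc i)))) (map (\<lambda>G. G e) Zs))"
      by (intro Pr.IH(2) computable_shift2[OF Pr.prems(1)] Zs)
    then have g: "computable (\<lambda>e. eval_fuel g (S (\<lambda>i. e (Suc (Suc i))))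
        (e 0 # (e 1 - 1) # map (\<lambda>G. G (\<lambda>i. e (Suc (Suc i)))) Ys))"
      by (simp add: Zs_def comp_def)
    have "computable (\<lambda>e. rec_nat (eval_fuel f (S e) (map (\<lambda>G. G e) Ys))
        (\<lambda>m y. if y = 0 then 0 else eval_fuel g (S e) (m # (y - 1) # map (\<lambda>G. G e) Ys)) (N e))"
      using g Pr.IH(1)[OF Pr.prems(1) Ys] Pr.prems(2)[of N] Cons
      by (intro computable_rec_nat computable_if decidable_eq computable_const computable_var) auto
    then show ?thesis by (simp add: Cons)
  qed
next
  case (Mn f)
  define Zs where "Zs = (\<lambda>e. e 0) # map (\<lambda>G e. G (\<lambda>i. e (Suc i))) Gs"
  have Zs: "computable G" if "G \<in> set Zs" for G
    using that Mn.prems(2) unfolding Zs_def by (auto intro: computable_shift computable_var)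
  have "computable (\<lambda>e. eval_fuel f (S (\<lambda>i. e (Suc i))) (map (\<lambda>G. G e) Zs))"
    by (intro Mn.IH computable_shift[OF Mn.prems(1)] Zs)
  then have f: "computable (\<lambda>e. eval_fuel f (S (\<lambda>i. e (Suc i))) (e 0 # map (\<lambda>G. G (\<lambda>i. e (Suc i))) Gs))"
    by (simp add: Zs_def comp_def)
  define M where "M e = (LEAST m. m \<ge> S e \<or> eval_fuel f (S e) (m # map (\<lambda>G. G e) Gs) \<le> 1)" for e
  have M: "computable M"
    unfolding M_def using f computable_shift[OF Mn.prems(1)]
    by (intro computable_Least decidable_disj decidable_le computable_var computable_const) auto
  have "computable (\<lambda>e. eval_fuel f (S e) (M e # map (\<lambda>G. G e) Gs))"
    using computable_let[OF f M] .
  then have "computable (\<lambda>e. if M e < S e \<and> eval_fuel f (S e) (M e # map (\<lambda>G. G e) Gs) = 1 then Suc (M e) else 0)"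
    using M Mn.prems(1)
    by (intro computable_if computable_Suc decidable_conj decidable_less decidable_eq computable_const)
  then show ?case by (simp only: eval_fuel.simps M_def Let_def)
qed

section \<open>Monotone enumerations on codes\<close>

text \<open>A total function \<open>h\<close> stands for a partial one: \<open>h n t = 0\<close> means undefined and
  \<open>h n t = Suc x\<close> means that the value is \<open>x\<close>.\<close>

definition computable2 :: "(nat \<Rightarrow> nat \<Rightarrow> nat) \<Rightarrow> bool" where
  "computable2 h \<longleftrightarrow> computable (\<lambda>e. h (e 0) (e 1))"

definition increasing :: "(nat \<Rightarrow> nat \<Rightarrow> bool) \<Rightarrow> (nat \<Rightarrow> nat \<Rightarrow> nat) \<Rightarrow> bool" where
  "increasing L h \<longleftrightarrow> (\<forall>n s t x y. s \<le> t \<longrightarrow> h n s = Suc x \<longrightarrow> h n t = Suc y \<longrightarrow> x = y \<or> L x y)"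

definition vals :: "(nat \<Rightarrow> nat \<Rightarrow> nat) \<Rightarrow> nat \<Rightarrow> nat set" where
  "vals h n = {x. \<exists>t. h n t = Suc x}"

definition decidable_order :: "(nat \<Rightarrow> nat \<Rightarrow> bool) \<Rightarrow> bool" where
  "decidable_order L \<longleftrightarrow> decidable (\<lambda>e. L (e 0) (e 1)) \<and> (\<forall>x. \<not> L x x) \<and>
     (\<forall>x y z. L x y \<longrightarrow> L y z \<longrightarrow> L x z)"

definition code_order :: "(nat \<Rightarrow> 'd) \<Rightarrow> ('d \<Rightarrow> 'd \<Rightarrow> bool) \<Rightarrow> nat \<Rightarrow> nat \<Rightarrow> bool" where
  "code_order rho lt x y \<longleftrightarrow> lt (rho x) (rho y)"

section \<open>Codes of strings, and total functions standing for partial ones\<close>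

fun nat_of_bl :: "bool list \<Rightarrow> nat" where
  "nat_of_bl [] = 0"
| "nat_of_bl (b # bs) = Suc (2 * nat_of_bl bs + (if b then 1 else 0))"

lemma bl_of_nat_nat_of_bl [simp]: "bl_of_nat (nat_of_bl p) = p"
  by (induction p) auto

lemma nat_of_bl_bl_of_nat [simp]: "nat_of_bl (bl_of_nat n) = n"
  by (induction n rule: bl_of_nat.induct) (auto simp: odd_two_times_div_two_nat)

lemma nat_of_bl_less: "length p < N \<Longrightarrow> nat_of_bl p < 2 ^ N"
proof -
  assume "length p < N"
  \<comment> \<open>The summand 2 makes the bound inductive, since the larger successor of
    \<open>x\<close> is \<open>2 * x + 2\<close>.\<close>
  have "nat_of_bl p + 2 \<le> 2 ^ Suc (length p)" by (induction p) auto
  also have "\<dots> \<le> 2 ^ N" using \<open>length p < N\<close> by (intro power_increasing) auto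
  finally show ?thesis by simp
qed

lemma length_bl_of_nat_le: "length (bl_of_nat n) \<le> n"
proof (induction n rule: bl_of_nat.induct)
  case (2 n)
  then show ?case by (cases "even n") (auto intro: order_trans[OF _ div_le_dividend])
qed auto

lemma computable2I:
  assumes "\<And>x y z. eval r [x, y] z \<longleftrightarrow> z = h x y"
  shows "computable2 h"
  unfolding computable2_def computable_def
  by (rule exI[of _ r], rule exI[of _ 2]) (use assms in \<open>simp add: upt_rec\<close>)

lemma comp_poset_decidable_order:
  assumes "comp_poset lt rho"
  shows "decidable_order (code_order rho lt)"
proof -
  let ?A = "\<lambda>m n. if code_order rho lt m n then 1 else 0::nat"
  have "total_computable2 ?A" using assms by (simp add: comp_poset_def code_order_def)
  then obtain r where "\<And>x y z. eval r [x, y] z \<longleftrightarrow> z = ?A x y"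
    unfolding total_computable2_def pcomp2_def option.inject by metis
  then have "computable2 ?A" by (rule computable2I)
  then show ?thesis
    using assms by (auto simp: decidable_order_def decidable_def computable2_def comp_poset_def code_order_def)
qed

lemma computable2_app:
  assumes "computable2 h" "computable F" "computable G"
  shows "computable (\<lambda>e. h (F e) (G e))"
  using assms unfolding computable2_def by (rule computable_app2)

lemma decidable_order_app:
  assumes "decidable_order L" "computable F" "computable G"
  shows "decidable (\<lambda>e. L (F e) (G e))"
  using assms unfolding decidable_order_def decidable_def
  by (auto intro: computable_app2[of "\<lambda>x y. if L x y then 1 else 0"])

text \<open>\<open>Mn\<close> searches for \<open>z\<close> with \<open>h x t = Suc z\<close>: it
  finds the value if there is one and runs forever if \<open>h x t = 0\<close>.\<close>

lemma pcomp2_of_computable2: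
  assumes h: "computable2 h"
  shows "pcomp2 (\<lambda>x t. case h x t of 0 \<Rightarrow> None | Suc y \<Rightarrow> Some y)"
proof -
  have "computable (\<lambda>e. if h (e 1) (e 2) = Suc (e 0) then 0 else 1)"
    by (intro computable_intros computable2_app[OF h])
  then obtain r k where r: "\<And>e y. eval r (map e [0..<k]) y \<longleftrightarrow>
      y = (if h (e 1) (e 2) = Suc (e 0) then 0 else 1)"
    by (auto simp: computable_def)
  \<comment> \<open>The program \<open>r\<close> has some arity \<open>k\<close>, but only the
    variables 0, 1 and 2 matter; any further inputs are filled with 0.\<close>
  define q where "q = Cn r (map (\<lambda>i. if i < 3 then Proj i else Zr) [0..<k])"
  have q: "eval q [z, x, t] y \<longleftrightarrow> y = (if h x t = Suc z then 0 else 1)" for x t z y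
  proof -
    let ?e = "case_nat z (case_nat x (case_nat t (\<lambda>_. 0)))"
    have "list_all2 (\<lambda>g y. eval g [z, x, t] y) (map (\<lambda>i. if i < 3 then Proj i else Zr) [0..<k]) ys
        \<longleftrightarrow> list_all2 (\<lambda>i y. y = ?e i) [0..<k] ys" for ys
      unfolding list_all2_map1
    proof (intro list.rel_cong refl)
      fix i y
      consider "i = 0" | "i = 1" | "i = 2" | j where "i = Suc (Suc (Suc j))"
        by (metis One_nat_def Suc_1 not0_implies_Suc)
      then show "eval (if i < 3 then Proj i else Zr) [z, x, t] y \<longleftrightarrow> y = ?e i"
        by cases (auto simp: eval_Proj_iff eval_Zr_iff)
    qed
    then have "eval q [z, x, t] y \<longleftrightarrow> eval r (map ?e [0..<k]) y"
      unfolding q_def eval_Cn_iff by (simp only: list_all2_eq_map) simp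
    then show ?thesis by (simp add: r numeral_2_eq_2)
  qed
  have "eval (Mn q) [x, t] y \<longleftrightarrow> h x t = Suc y" for x t y
    unfolding eval_Mn_iff q by auto
  then show ?thesis
    unfolding pcomp2_def by (intro exI[of _ "Mn q"]) (auto split: nat.split)
qed

lemma comp_poset_conv_ord:
  assumes "comp_poset lt rho"
  shows "comp_poset (conv_ord lt) rho"
proof -
  have "decidable (\<lambda>e. code_order rho lt (e 1) (e 0))"
    by (intro decidable_order_app[OF comp_poset_decidable_order[OF assms]] computable_var)
  then have "computable2 (\<lambda>m n. Suc (if lt (rho n) (rho m) then 1 else 0))"
    unfolding computable2_def code_order_def by (intro computable_intros)
  from pcomp2_of_computable2[OF this] show ?thesis
    using assms unfolding comp_poset_def total_computable2_def conv_ord_def by auto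
qed

section \<open>Maxima of enumerations and optimal functions\<close>

lemma maxD_eq_SomeI:
  assumes "comp_poset lt rho" "finite (values_of f p)" "is_max lt (values_of f p) d"
  shows "maxD lt f p = Some d"
proof -
  have uniq: "m = d" if "is_max lt (values_of f p) m" for m
    using assms(1,3) that unfolding is_max_def comp_poset_def by metis
  have "(THE m. is_max lt (values_of f p) m) = d"
    using assms(3) uniq by (rule the_equality)
  moreover have "values_of f p \<noteq> {}"
    using assms(3) by (auto simp: is_max_def)
  ultimately show ?thesis
    using assms(2,3) unfolding maxD_def by metis
qed

lemma maxD_eq_SomeD:
  assumes "comp_poset lt rho" "maxD lt f p = Some d"
  shows "finite (values_of f p)" "is_max lt (values_of f p) d"
proof -
  show fin: "finite (values_of f p)"
    using assms(2) by (auto simp: maxD_def split: if_splits)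
  obtain m where m: "is_max lt (values_of f p) m"
    using assms(2) by (auto simp: maxD_def split: if_splits)
  then show "is_max lt (values_of f p) d"
    using maxD_eq_SomeI[OF assms(1) fin m] assms(2) by simp
qed

text \<open>With growing fuel the values of \<open>f\<close> may show up out of order. At stage
  \<open>u\<close> the enumeration shows the value at the largest argument below \<open>u\<close>
  that has converged; this argument only moves up, so monotonicity carries over. Values can be
  skipped, so only inclusion and the survival of a maximum are claimed: what is shown after the
  maximum has converged is above or equal to it, hence equal.\<close>

lemma monotone_enumeration:
  assumes P: "comp_poset lt rho" and f: "comp_fn rho f" "mono2 lt f"
  obtains h where "computable2 h" "increasing (code_order rho lt) h"
    "\<And>n. rho ` vals h n \<subseteq> values_of f (bl_of_nat n)"
    "\<And>n m. is_max lt (values_of f (bl_of_nat n)) (rho m) \<Longrightarrow> m \<in> vals h n"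
proof -
  have bij: "bij rho" using P by (simp add: comp_poset_def)
  then have inv: "inv rho d = x \<longleftrightarrow> d = rho x" for d x
    by (metis bij_inv_eq_iff)
  obtain r where r: "\<And>n t x. eval r [n, t] x \<longleftrightarrow> f (bl_of_nat n) t = Some (rho x)"
    using f(1) inv unfolding comp_fn_def pcomp2_def by auto
  define g where "g n u t = eval_fuel r u [n, t]" for n u t
  have gf: "f (bl_of_nat n) t = Some (rho x)" if "g n u t = Suc x" for n u t x
    using eval_fuel_sound[of r u "[n, t]" x] that r by (simp add: g_def)
  have g_mono: "g n u' t = Suc x" if "g n u t = Suc x" "u \<le> u'" for n u u' t x
    using eval_fuel_mono[of r u "[n, t]" x] that by (simp add: g_def)
  have g_complete: "\<exists>u. g n u t = Suc x" if "f (bl_of_nat n) t = Some (rho x)" for n t x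
    using eval_fuel_complete[of r "[n, t]" x] that r by (simp add: g_def)
  have cg: "computable (\<lambda>e. g (F e) (G e) (H e))" if "computable F" "computable G" "computable H" for F G H
    using computable_eval_fuel[OF that(2), of "[F, H]" r] that by (auto simp: g_def)
  \<comment> \<open>the value at the last argument below \<open>s\<close> at which \<open>f\<close> has converged within fuel \<open>u\<close>\<close>
  define l where "l n u s = rec_nat 0 (\<lambda>t y. if g n u t = 0 then y else g n u t) s" for n u s
  define h where "h n u = l n u u" for n u
  have l_Suc: "\<exists>t<s. g n u t = Suc x \<and> (\<forall>t'. t < t' \<longrightarrow> t' < s \<longrightarrow> g n u t' = 0)" if "l n u s = Suc x" for n u s x
    using that
  proof (induction s)
    case 0
    then show ?case by (simp add: l_def)
  next
    case (Suc s)
    show ?case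
    proof (cases "g n u s = 0")
      case True
      with Suc show ?thesis by (auto simp: l_def less_Suc_eq)
    next
      case False
      with Suc.prems show ?thesis by (intro exI[of _ s]) (auto simp: l_def)
    qed
  qed
  have l_nz: "l n u s \<noteq> 0" if "t < s" "g n u t \<noteq> 0" for n u s t
    using that by (induction s) (auto simp: l_def less_Suc_eq)
  have mono: "x = y \<or> lt (rho x) (rho y)"
    if "f (bl_of_nat n) s = Some (rho x)" "f (bl_of_nat n) t = Some (rho y)" "s \<le> t" for n s t x y
    using f(2) that bij unfolding mono2_def by (metis bij_pointE)
  show thesis
  proof
    show "computable2 h"
      unfolding computable2_def h_def l_def
      by (intro computable_intros cg)
    show "increasing (code_order rho lt) h"
      unfolding increasing_def code_order_def
    proof (intro allI impI)
      fix n u u' x y assume *: "u \<le> u'" "h n u = Suc x" "h n u' = Suc y"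
      obtain t where t: "t < u" "g n u t = Suc x" using l_Suc *(2) unfolding h_def by blast
      obtain t' where t': "t' < u'" "g n u' t' = Suc y" "\<And>i. t' < i \<Longrightarrow> i < u' \<Longrightarrow> g n u' i = 0"
        using l_Suc *(3) unfolding h_def by blast
      have "t \<le> t'"
        using t'(3)[of t] g_mono[OF t(2) *(1)] t(1) *(1) by (cases "t \<le> t'") auto
      then show "x = y \<or> lt (rho x) (rho y)" using mono gf t(2) t'(2) by blast
    qed
    show "rho ` vals h n \<subseteq> values_of f (bl_of_nat n)" for n
      using l_Suc gf unfolding h_def vals_def values_of_def by blast
    fix n m assume max: "is_max lt (values_of f (bl_of_nat n)) (rho m)"
    then obtain t where t: "f (bl_of_nat n) t = Some (rho m)"
      by (auto simp: is_max_def values_of_def)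
    then obtain u0 where u0: "g n u0 t = Suc m" using g_complete by blast
    define u where "u = u0 + Suc t"
    have gu: "g n u t = Suc m" using g_mono[OF u0] by (simp add: u_def)
    then have "h n u \<noteq> 0" unfolding h_def using l_nz[of t u] by (simp add: u_def)
    then obtain y where y: "h n u = Suc y" using not0_implies_Suc by blast
    then obtain t' where t': "g n u t' = Suc y" "\<And>i. t' < i \<Longrightarrow> i < u \<Longrightarrow> g n u i = 0"
      using l_Suc unfolding h_def by blast
    have "t \<le> t'" using t'(2)[of t] gu by (cases "t \<le> t'") (auto simp: u_def)
    then have "m = y \<or> lt (rho m) (rho y)" using mono t gf[OF t'(1)] by blast
    moreover have "rho y \<in> values_of f (bl_of_nat n)" using gf[OF t'(1)] by (auto simp: values_of_def)
    then have "rho y = rho m \<or> lt (rho y) (rho m)" using max by (simp add: is_max_def)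
    ultimately have "y = m" using P bij unfolding comp_poset_def by (metis bij_pointE)
    then show "m \<in> vals h n" using y by (auto simp: vals_def)
  qed
qed

text \<open>Decoding \<open>h\<close> gives a member of the class for which
  \<open>bl_of_nat n\<close> is a program for the maximum of \<open>vals h n\<close>. Together with
  \<open>optimal_max_attained\<close>, this moves the comparisons to total functions on
  codes.\<close>

lemma optimal_max_le:
  assumes P: "comp_poset lt rho" and U: "optimal_max lt rho U"
    and h: "computable2 h" "increasing (code_order rho lt) h"
  shows "\<exists>c. \<forall>n m. finite (vals h n) \<and> is_max (code_order rho lt) (vals h n) m \<longrightarrow>
    (\<exists>q. U q = Some (rho m)) \<and> KU U (rho m) \<le> length (bl_of_nat n) + c"
proof -
  have bij: "bij rho" using P by (simp add: comp_poset_def)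
  define f where "f p t = (case h (nat_of_bl p) t of 0 \<Rightarrow> None | Suc x \<Rightarrow> Some (rho x))" for p t
  have "map_option (inv rho) (f (bl_of_nat n) t) = (case h n t of 0 \<Rightarrow> None | Suc x \<Rightarrow> Some x)" for n t
    using bij by (simp add: f_def bij_is_inj split: nat.split)
  then have "comp_fn rho f" using pcomp2_of_computable2[OF h(1)] by (simp add: comp_fn_def)
  moreover have "mono2 lt f"
    using h(2) unfolding mono2_def increasing_def f_def code_order_def
    by (auto split: nat.splits) metis
  ultimately have "maxD lt f \<in> MaxPR lt rho" by (auto simp: MaxPR_def)
  then obtain c where c: "\<And>d p. maxD lt f p = Some d \<Longrightarrow> (\<exists>q. U q = Some d) \<and> KU U d \<le> KU (maxD lt f) d + c"
    using U unfolding optimal_max_def by metis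
  have "f (bl_of_nat n) t = Some d \<longleftrightarrow> (\<exists>x. h n t = Suc x \<and> d = rho x)" for n t d
    by (auto simp: f_def split: nat.splits)
  then have vals: "values_of f (bl_of_nat n) = rho ` vals h n" for n
    by (auto simp: values_of_def vals_def)
  have "(\<exists>q. U q = Some (rho m)) \<and> KU U (rho m) \<le> length (bl_of_nat n) + c"
    if "finite (vals h n)" "is_max (code_order rho lt) (vals h n) m" for n m
  proof -
    have "is_max lt (values_of f (bl_of_nat n)) (rho m)"
      using that(2) by (auto simp: vals is_max_def code_order_def)
    then have *: "maxD lt f (bl_of_nat n) = Some (rho m)"
      using that(1) by (intro maxD_eq_SomeI[OF P]) (auto simp: vals)
    then have "KU (maxD lt f) (rho m) \<le> length (bl_of_nat n)"
      unfolding KU_def by (intro Least_le) blast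
    then show ?thesis using c[OF *] by fastforce
  qed
  then show ?thesis by blast
qed

lemma optimal_max_attained:
  assumes P: "comp_poset lt rho" and U: "optimal_max lt rho U"
  obtains h where "computable2 h" "increasing (code_order rho lt) h"
    "\<And>m. \<exists>n. length (bl_of_nat n) = KU U (rho m) \<and> finite (vals h n) \<and>
      is_max (code_order rho lt) (vals h n) m"
proof -
  have bij: "bij rho" using P by (simp add: comp_poset_def)
  obtain f where f: "comp_fn rho f" "mono2 lt f" and Uf: "U = maxD lt f"
    using U by (auto simp: optimal_max_def MaxPR_def)
  obtain h where h: "computable2 h" "increasing (code_order rho lt) h"
    "\<And>n. rho ` vals h n \<subseteq> values_of f (bl_of_nat n)"
    "\<And>n m. is_max lt (values_of f (bl_of_nat n)) (rho m) \<Longrightarrow> m \<in> vals h n"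
    by (rule monotone_enumeration[OF P f]) blast
  have "\<exists>n. length (bl_of_nat n) = KU U (rho m) \<and> finite (vals h n) \<and>
      is_max (code_order rho lt) (vals h n) m" for m
  proof -
    \<comment> \<open>On input \<open>n\<close> this enumeration lists only \<open>n\<close>, so by
      optimality \<open>U\<close> reaches every element, and the \<open>LEAST\<close> in
      \<open>KU\<close> is attained.\<close>
    have id: "computable2 (\<lambda>n t. Suc n)" "increasing (code_order rho lt) (\<lambda>n t. Suc n)"
      by (auto simp: computable2_def increasing_def intro!: computable_intros)
    have "vals (\<lambda>n t. Suc n) m = {m}" by (auto simp: vals_def)
    then have "\<exists>q. U q = Some (rho m)"
      using optimal_max_le[OF P U id] by (metis finite.emptyI finite_insert is_max_def singletonD singletonI)
    then have "\<exists>l p. length p = l \<and> U p = Some (rho m)" by blast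
    then obtain p where p: "length p = KU U (rho m)" "U p = Some (rho m)"
      using LeastI_ex[of "\<lambda>l. \<exists>p. length p = l \<and> U p = Some (rho m)"] unfolding KU_def by blast
    define n where "n = nat_of_bl p"
    have n: "bl_of_nat n = p" by (simp add: n_def)
    have fin: "finite (values_of f p)" and max: "is_max lt (values_of f p) (rho m)"
      using maxD_eq_SomeD[OF P] p(2) Uf by auto
    have "inj_on rho (vals h n)" using bij by (metis bij_is_inj inj_on_subset subset_UNIV)
    then have "finite (vals h n)"
      using h(3)[of n] fin n finite_subset finite_imageD by metis
    moreover have "is_max (code_order rho lt) (vals h n) m"
      unfolding is_max_def code_order_def
    proof (intro conjI ballI)
      show "m \<in> vals h n" using h(4) max n by simp
      fix x assume "x \<in> vals h n"
      then have "rho x \<in> values_of f p" using h(3)[of n] n by blast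
      then show "x = m \<or> lt (rho x) (rho m)"
        using max bij_is_inj[OF bij] unfolding is_max_def by (metis injD)
    qed
    ultimately show ?thesis using p n by metis
  qed
  then show thesis using that h by blast
qed

section \<open>Chains of the stronger order that are antichains of the weaker one\<close>

lemma less_set_encode:
  assumes "finite A" shows "x \<in> A \<Longrightarrow> x < set_encode A"
proof -
  assume "x \<in> A"
  have "x < 2 ^ x" by (rule less_exp)
  also have "\<dots> = sum ((^) 2) {x}" by simp
  also have "\<dots> \<le> set_encode A"
    unfolding set_encode_def using assms \<open>x \<in> A\<close> by (intro sum_mono2) auto
  finally show ?thesis .
qed

text \<open>This turns quantification over the set coded by \<open>c\<close> into bounded
  quantification.\<close>

lemma set_decode_less: "x \<in> set_decode c \<Longrightarrow> x < c"
  using less_set_encode[OF finite_set_decode, of x c] by simp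

lemma computable_card_set_decode:
  assumes "computable F"
  shows "computable (\<lambda>e. card (set_decode (F e)))"
proof -
  have "computable (\<lambda>e. \<Sum>x<F e. if x \<in> set_decode (F e) then 1 else 0)"
    by (intro computable_intros assms computable_shift[OF assms])
  moreover have "(\<Sum>x<c. if x \<in> set_decode c then 1 else 0) = card (set_decode c)" for c
  proof -
    have "{..<c} \<inter> set_decode c = set_decode c" using set_decode_less by auto
    then show ?thesis by (simp add: sum.If_cases Int_def[symmetric])
  qed
  ultimately show ?thesis by simp
qed

lemma decidable_ball_set_decode:
  assumes "computable F" "decidable (\<lambda>e. P (e 0) (\<lambda>i. e (Suc i)))"
  shows "decidable (\<lambda>e. \<forall>x\<in>set_decode (F e). P x e)"
proof -
  have "decidable (\<lambda>e. \<forall>x<F e. x \<in> set_decode (F e) \<longrightarrow> P x e)"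
    by (intro computable_intros assms computable_shift[OF assms(1)])
  moreover have "(\<forall>x<c. x \<in> set_decode c \<longrightarrow> Q x) \<longleftrightarrow> (\<forall>x\<in>set_decode c. Q x)" for c Q
    using set_decode_less by auto
  ultimately show ?thesis by simp
qed

definition chain_antichain :: "('a \<Rightarrow> 'a \<Rightarrow> bool) \<Rightarrow> ('a \<Rightarrow> 'a \<Rightarrow> bool) \<Rightarrow> 'a set \<Rightarrow> bool" where
  "chain_antichain L W S \<longleftrightarrow> (\<forall>x\<in>S. \<forall>y\<in>S. x \<noteq> y \<longrightarrow> L x y \<or> L y x) \<and> (\<forall>x\<in>S. \<forall>y\<in>S. \<not> W x y)"

definition unbounded_chain_antichain :: "(nat \<Rightarrow> nat \<Rightarrow> bool) \<Rightarrow> (nat \<Rightarrow> nat \<Rightarrow> bool) \<Rightarrow> bool" where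
  "unbounded_chain_antichain L W \<longleftrightarrow> (\<forall>k. \<exists>S. finite S \<and> card S = k \<and> chain_antichain L W S)"

lemma increasing_vals_chain:
  assumes "increasing L h" "x \<in> vals h n" "y \<in> vals h n"
  shows "x = y \<or> L x y \<or> L y x"
proof -
  obtain s t where "h n s = Suc x" "h n t = Suc y" using assms(2,3) by (auto simp: vals_def)
  moreover have "s \<le> t \<or> t \<le> s" by (rule nat_le_linear)
  ultimately show ?thesis using assms(1) unfolding increasing_def by blast
qed

lemma obtain_least_in_chain:
  assumes L: "\<And>x. \<not> L x x" "\<And>x y z. L x y \<Longrightarrow> L y z \<Longrightarrow> L x z"
    and S: "finite S" "S \<noteq> {}" "\<And>x y. x \<in> S \<Longrightarrow> y \<in> S \<Longrightarrow> x \<noteq> y \<Longrightarrow> L x y \<or> L y x"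
  shows "\<exists>m\<in>S. \<forall>y\<in>S. y = m \<or> L m y"
  using S
proof (induction S rule: finite_ne_induct)
  case (insert a S)
  then obtain m where m: "m \<in> S" "\<And>y. y \<in> S \<Longrightarrow> y = m \<or> L m y" by blast
  show ?case
  proof (cases "L a m")
    case True
    then have "\<forall>y\<in>insert a S. y = a \<or> L a y" using m(2) L(2) by blast
    then show ?thesis by blast
  next
    case False
    then have "L m a" using insert.prems[of a m] insert.hyps m(1) by auto
    then show ?thesis using m by blast
  qed
qed auto

text \<open>A \<open>W\<close>-antichain meets each of the \<open>2 * M n\<close> enumerations at
  most once, so if it has more elements, one is never listed. The new enumeration shows the
  \<open>L\<close>-least element not listed so far, which moves up only when it gets listed
  itself.\<close>

lemma avoiding_enumeration:
  assumes L: "decidable_order L" and W: "decidable_order W"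
    and star: "unbounded_chain_antichain L W"
    and h1: "computable2 h1" "increasing W h1"
    and h2: "computable2 h2" "increasing (\<lambda>x y. W y x) h2"
    and M: "computable (\<lambda>e. M (e 0))"
  obtains h where "computable2 h" "increasing L h"
    "\<And>n. \<exists>m. finite (vals h n) \<and> is_max L (vals h n) m \<and> (\<forall>i<M n. m \<notin> vals h1 i \<and> m \<notin> vals h2 i)"
proof -
  note Lapp = decidable_order_app[OF L] and Wapp = decidable_order_app[OF W]
  note h1app = computable2_app[OF h1(1)] and h2app = computable2_app[OF h2(1)]
  note Mapp = computable_app1[OF M]
  have Lirr: "\<not> L x x" and Ltr: "L x y \<Longrightarrow> L y z \<Longrightarrow> L x z" for x y z
    using L by (auto simp: decidable_order_def)
  define bad where "bad n t x \<longleftrightarrow> (\<exists>i<M n. \<exists>u<t. h1 i u = Suc x \<or> h2 i u = Suc x)" for n t x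
  have bad_mono: "bad n t x" if "bad n s x" "s \<le> t" for n s t x
    using that unfolding bad_def by (meson order_less_le_trans)
  define good where "good n c \<longleftrightarrow> chain_antichain L W (set_decode c) \<and> 2 * M n < card (set_decode c)" for n c
  have ex_good: "\<exists>c. good n c" for n
  proof -
    obtain S where "finite S" "card S = Suc (2 * M n)" "chain_antichain L W S"
      using star unfolding unbounded_chain_antichain_def by metis
    then show ?thesis by (intro exI[of _ "set_encode S"]) (simp add: good_def)
  qed
  \<comment> \<open>The chain is found by search through the codes of finite sets,
    \<open>good\<close> being decidable.\<close>
  define C where "C n = (LEAST c. good n c)" for n
  have C: "good n (C n)" for n
    unfolding C_def by (rule LeastI_ex[OF ex_good])
  have comp_C: "computable (\<lambda>e. C (F e))" if "computable F" for F
  proof -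
    have "computable (\<lambda>e. LEAST c. good (e 0) c)"
      by (rule computable_Least)
        (use ex_good in \<open>auto simp: good_def chain_antichain_def intro!: decidable_ball_set_decode computable_intros
          computable_card_set_decode Lapp Wapp Mapp\<close>)
    then have "computable (\<lambda>e. C (e 0))" by (simp add: C_def)
    from computable_app1[OF this that] show ?thesis .
  qed
  \<comment> \<open>The \<open>L\<close>-least element not yet bad, expressed with bounded
    quantifiers only and hence decidable.\<close>
  define R where "R n t x \<longleftrightarrow> x \<in> set_decode (C n) \<and> \<not> bad n t x \<and>
      (\<forall>y\<in>set_decode (C n). L y x \<longrightarrow> bad n t y)" for n t x
  define B where "B n = {x \<in> set_decode (C n). \<exists>t. bad n t x}" for n
  have meet: "card (vals g i \<inter> set_decode (C n)) \<le> 1"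
    if g: "\<And>x y. x \<in> vals g i \<Longrightarrow> y \<in> vals g i \<Longrightarrow> x = y \<or> W x y \<or> W y x" for g i n
  proof -
    have "x = y" if "x \<in> vals g i \<inter> set_decode (C n)" "y \<in> vals g i \<inter> set_decode (C n)" for x y
      using that g C[of n] unfolding good_def chain_antichain_def by blast
    then show ?thesis by (simp add: card_le_Suc0_iff_eq)
  qed
  have chain1: "x = y \<or> W x y \<or> W y x" if "x \<in> vals h1 i" "y \<in> vals h1 i" for i x y
    by (rule increasing_vals_chain[OF h1(2) that])
  have chain2: "x = y \<or> W x y \<or> W y x" if "x \<in> vals h2 i" "y \<in> vals h2 i" for i x y
    using increasing_vals_chain[OF h2(2) that] by blast
  have card_B: "card (B n) \<le> 2 * M n" for n
  proof -
    have "B n \<subseteq> (\<Union>i<M n. vals h1 i \<inter> set_decode (C n)) \<union> (\<Union>i<M n. vals h2 i \<inter> set_decode (C n))"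
      by (auto simp: B_def bad_def vals_def)
    then have "card (B n) \<le> card ((\<Union>i<M n. vals h1 i \<inter> set_decode (C n)) \<union> (\<Union>i<M n. vals h2 i \<inter> set_decode (C n)))"
      by (intro card_mono) auto
    also have "\<dots> \<le> card (\<Union>i<M n. vals h1 i \<inter> set_decode (C n)) + card (\<Union>i<M n. vals h2 i \<inter> set_decode (C n))"
      by (rule card_Un_le)
    also have "\<dots> \<le> (\<Sum>i<M n. card (vals h1 i \<inter> set_decode (C n))) + (\<Sum>i<M n. card (vals h2 i \<inter> set_decode (C n)))"
      by (intro add_mono card_UN_le) auto
    also have "\<dots> \<le> (\<Sum>i<M n. 1) + (\<Sum>i<M n. 1)"
      by (intro add_mono sum_mono meet chain1 chain2)
    finally show ?thesis by simp
  qed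
  have ex_R: "\<exists>x. R n t x" for n t
  proof -
    let ?S = "{x \<in> set_decode (C n). \<not> bad n t x}"
    have "\<not> set_decode (C n) \<subseteq> B n"
    proof
      assume "set_decode (C n) \<subseteq> B n"
      then have "card (set_decode (C n)) \<le> card (B n)" by (intro card_mono) (auto simp: B_def)
      then show False using card_B[of n] C[of n] by (simp add: good_def)
    qed
    then have "?S \<noteq> {}" by (auto simp: B_def)
    then obtain m where "m \<in> ?S" "\<forall>y\<in>?S. y = m \<or> L m y"
      using obtain_least_in_chain[of L ?S] Lirr Ltr C[of n] unfolding good_def chain_antichain_def by auto
    then have "R n t m" unfolding R_def using Lirr Ltr[of m _ m] by fastforce
    then show ?thesis ..
  qed
  define f where "f n t = (LEAST x. R n t x)" for n t
  have f: "R n t (f n t)" for n t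
    unfolding f_def by (rule LeastI_ex[OF ex_R])
  have f_mono: "f n s = f n t \<or> L (f n s) (f n t)" if "s \<le> t" for n s t
  proof -
    \<comment> \<open>Everything \<open>L\<close>-below \<open>f n s\<close> was bad at stage
      \<open>s\<close> and remains so, hence \<open>f n t\<close> is not below
      \<open>f n s\<close>.\<close>
    have "f n s \<in> set_decode (C n)" "f n t \<in> set_decode (C n)" "\<not> L (f n t) (f n s)"
      using f[of n s] f[of n t] bad_mono[OF _ that] unfolding R_def by blast+
    then show ?thesis using C[of n] unfolding good_def chain_antichain_def by blast
  qed
  define h where "h n t = Suc (f n t)" for n t
  have vals: "vals h n = range (f n)" for n by (auto simp: vals_def h_def)
  show thesis
  proof
    show "computable2 h"
      unfolding computable2_def h_def f_def
    proof (intro computable_Suc computable_Least)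
      show "decidable (\<lambda>e. R (e (Suc 0)) (e (Suc 1)) (e 0))"
        unfolding R_def bad_def
        by (intro computable_intros decidable_ball_set_decode comp_C h1app h2app Mapp Lapp)
    qed (rule ex_R)
    show "increasing L h"
      using f_mono by (auto simp: increasing_def h_def)
    fix n
    have fin: "finite (range (f n))"
      by (rule finite_subset[of _ "set_decode (C n)"]) (use f in \<open>auto simp: R_def\<close>)
    have "\<exists>m\<in>range (f n). \<forall>y\<in>range (f n). y = m \<or> L y m"
    proof (rule obtain_least_in_chain[where L = "\<lambda>x y. L y x"])
      fix x y assume "x \<in> range (f n)" "y \<in> range (f n)" "x \<noteq> y"
      then show "L y x \<or> L x y" using f_mono by (metis nat_le_linear rangeE)
    qed (use Lirr Ltr fin in auto)
    \<comment> \<open>The range is a finite chain, so its largest element is reached at some stage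
      \<open>s\<close>. From then on the enumeration is constant, so this value never becomes
      bad.\<close>
    then obtain s where s: "\<And>t. f n t = f n s \<or> L (f n t) (f n s)" by blast
    have stable: "f n t = f n s" if "s \<le> t" for t
      using f_mono[OF that, of n] s[of t] Lirr Ltr by metis
    have "\<not> bad n t (f n s)" for t
    proof
      assume "bad n t (f n s)"
      then have "bad n (max s t) (f n (max s t))"
        using stable[of "max s t"] bad_mono[of n t "f n s" "max s t"] by simp
      then show False using f[of n "max s t"] by (simp add: R_def)
    qed
    then have "\<forall>i<M n. f n s \<notin> vals h1 i \<and> f n s \<notin> vals h2 i"
      unfolding bad_def vals_def by blast
    moreover have "is_max L (vals h n) (f n s)"
      using s by (auto simp: vals is_max_def)
    ultimately show "\<exists>m. finite (vals h n) \<and> is_max L (vals h n) m \<and> (\<forall>i<M n. m \<notin> vals h1 i \<and> m \<notin> vals h2 i)"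
      using fin vals by metis
  qed
qed

lemma infinitely_many_large:
  assumes Pst: "comp_poset lst rho" and Pwk: "comp_poset lwk rho"
    and star: "unbounded_chain_antichain (code_order rho lst) (code_order rho lwk)"
    and U: "optimal_max lst rho U" and V1: "optimal_max lwk rho V1" and V2: "optimal_max (conv_ord lwk) rho V2"
    and a: "total_computable1 a"
  shows "infinite {d. a (KU U d) \<le> KU V1 d \<and> a (KU U d) \<le> KU V2 d}"
proof -
  let ?L = "code_order rho lst" and ?W = "code_order rho lwk"
  have bij: "bij rho" using Pst by (simp add: comp_poset_def)
  have Pcw: "comp_poset (conv_ord lwk) rho" using Pwk by (rule comp_poset_conv_ord)
  have conv: "code_order rho (conv_ord lwk) = (\<lambda>x y. ?W y x)"
    by (auto simp: code_order_def conv_ord_def fun_eq_iff)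
  obtain h1 where h1: "computable2 h1" "increasing ?W h1"
    "\<And>m. \<exists>n. length (bl_of_nat n) = KU V1 (rho m) \<and> finite (vals h1 n) \<and> is_max ?W (vals h1 n) m"
    using optimal_max_attained[OF Pwk V1] by metis
  obtain h2 where h2: "computable2 h2" "increasing (\<lambda>x y. ?W y x) h2"
    "\<And>m. \<exists>n. length (bl_of_nat n) = KU V2 (rho m) \<and> finite (vals h2 n) \<and> is_max (\<lambda>x y. ?W y x) (vals h2 n) m"
    using optimal_max_attained[OF Pcw V2] unfolding conv by metis
  \<comment> \<open>For \<open>n \<ge> c\<close> the element found will have strong complexity at
    most \<open>2 * n\<close>, so the sum bounds \<open>a\<close> there whatever the exact
    complexity is. The summand \<open>n\<close> makes the weak complexities unbounded. Strings
    shorter than \<open>N n\<close> have codes below \<open>2 ^ N n\<close>.\<close>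
  define N where "N n = n + (\<Sum>i<Suc (2 * n). a i)" for n
  define M :: "nat \<Rightarrow> nat" where "M n = 2 ^ N n" for n
  have ca: "computable (\<lambda>e. a (e 0))"
  proof -
    obtain r where r: "\<And>x y. eval r [x] y \<longleftrightarrow> y = a x"
      using a unfolding total_computable1_def pcomp1_def option.inject by metis
    then show ?thesis unfolding computable_def
      by (intro exI[of _ r] exI[of _ 1]) simp
  qed
  have M: "computable (\<lambda>e. M (e 0))"
    unfolding M_def N_def by (intro computable_intros computable_app1[OF ca])
  obtain h where h: "computable2 h" "increasing ?L h"
    "\<And>n. \<exists>m. finite (vals h n) \<and> is_max ?L (vals h n) m \<and> (\<forall>i<M n. m \<notin> vals h1 i \<and> m \<notin> vals h2 i)"
    by (rule avoiding_enumeration[OF comp_poset_decidable_order[OF Pst] comp_poset_decidable_order[OF Pwk]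
          star h1(1,2) h2(1,2) M]) blast
  obtain c where c: "\<And>n m. finite (vals h n) \<Longrightarrow> is_max ?L (vals h n) m \<Longrightarrow>
      KU U (rho m) \<le> length (bl_of_nat n) + c"
    using optimal_max_le[OF Pst U h(1,2)] by blast
  let ?D = "{d. a (KU U d) \<le> KU V1 d \<and> a (KU U d) \<le> KU V2 d}"
  have large: "\<exists>d\<in>?D. n \<le> KU V1 d" if "c \<le> n" for n
  proof -
    obtain m where m: "finite (vals h n)" "is_max ?L (vals h n) m"
      "\<And>i. i < M n \<Longrightarrow> m \<notin> vals h1 i \<and> m \<notin> vals h2 i" using h(3) by blast
    have "KU U (rho m) \<le> 2 * n"
      using c[OF m(1,2)] length_bl_of_nat_le[of n] that by linarith
    then have "a (KU U (rho m)) \<le> (\<Sum>i<Suc (2 * n). a i)"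
      by (intro member_le_sum) auto
    then have "a (KU U (rho m)) \<le> N n" by (simp add: N_def)
    moreover have "N n \<le> KU V1 (rho m)"
    proof -
      obtain i where i: "length (bl_of_nat i) = KU V1 (rho m)" "m \<in> vals h1 i"
        using h1(3)[of m] by (auto simp: is_max_def)
      then have "\<not> i < M n" using m(3) by blast
      then show ?thesis using nat_of_bl_less[of "bl_of_nat i" "N n"] i(1) by (force simp: M_def)
    qed
    moreover have "N n \<le> KU V2 (rho m)"
    proof -
      obtain i where i: "length (bl_of_nat i) = KU V2 (rho m)" "m \<in> vals h2 i"
        using h2(3)[of m] by (auto simp: is_max_def)
      then have "\<not> i < M n" using m(3) by blast
      then show ?thesis using nat_of_bl_less[of "bl_of_nat i" "N n"] i(1) by (force simp: M_def)
    qed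
    ultimately show ?thesis by (intro bexI[of _ "rho m"]) (auto simp: N_def)
  qed
  show ?thesis
  proof
    assume fin: "finite ?D"
    \<comment> \<open>Applied beyond the sum of all complexities over the supposedly finite set,
      \<open>large\<close> gives an element whose own term exceeds that sum.\<close>
    obtain d where d: "d \<in> ?D" "c + Suc (\<Sum>d\<in>?D. KU V1 d) \<le> KU V1 d"
      using large[of "c + Suc (\<Sum>d\<in>?D. KU V1 d)"] by auto
    have "KU V1 d \<le> (\<Sum>d\<in>?D. KU V1 d)" using fin d(1) by (intro member_le_sum) auto
    then show False using d(2) by simp
  qed
qed

section \<open>Joins of maximal antichains\<close>

text \<open>If some proper subfamily is tight, match it and its complement separately; otherwise
  match one vertex arbitrarily.\<close>

lemma hall_matching:
  assumes "finite I" "\<And>i. i \<in> I \<Longrightarrow> finite (A i)" "\<And>J. J \<subseteq> I \<Longrightarrow> card J \<le> card (\<Union>i\<in>J. A i)"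
  shows "\<exists>f. inj_on f I \<and> (\<forall>i\<in>I. f i \<in> A i)"
  using assms
proof (induction "card I" arbitrary: I A rule: less_induct)
  case less
  note fin = less.prems(1,2) and hall = less.prems(3)
  have finU: "finite (\<Union>i\<in>J. A i)" if "J \<subseteq> I" for J
    using that fin by (intro finite_UN_I) (auto intro: finite_subset)
  consider "I = {}" | (tight) J where "J \<subset> I" "J \<noteq> {}" "card (\<Union>i\<in>J. A i) = card J"
    | (loose) "I \<noteq> {}" "\<And>J. J \<subset> I \<Longrightarrow> J \<noteq> {} \<Longrightarrow> card J < card (\<Union>i\<in>J. A i)"
    using hall by (metis order_le_imp_less_or_eq psubset_imp_subset)
  then show ?case
  proof cases
    case tight
    have finJ: "finite J" and J: "J \<subseteq> I" using tight(1) fin(1) finite_subset by auto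
    have "card J < card I" using tight(1) fin(1) by (rule psubset_card_mono[rotated])
    then obtain f where f: "inj_on f J" "\<forall>i\<in>J. f i \<in> A i"
      using less.hyps[of J A] finJ J fin(2) hall by (meson subset_trans subsetD)
    define B where "B i = A i - (\<Union>i\<in>J. A i)" for i
    have "card (I - J) < card I" using tight J fin(1) by (intro psubset_card_mono) auto
    \<comment> \<open>Hall's condition for the remainder: apply it to \<open>K\<close> together with
      \<open>J\<close>, then cancel the tight set \<open>J\<close>.\<close>
    moreover have "card K \<le> card (\<Union>i\<in>K. B i)" if "K \<subseteq> I - J" for K
    proof -
      have "finite K" using that fin(1) by (meson finite_Diff finite_subset)
      have "card K + card J = card (K \<union> J)"
        using that finJ \<open>finite K\<close> by (subst card_Un_disjoint) auto
      also have "\<dots> \<le> card (\<Union>i\<in>K \<union> J. A i)" using that J by (intro hall) auto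
      also have "(\<Union>i\<in>K \<union> J. A i) = (\<Union>i\<in>K. B i) \<union> (\<Union>i\<in>J. A i)" by (auto simp: B_def)
      also have "card \<dots> \<le> card (\<Union>i\<in>K. B i) + card (\<Union>i\<in>J. A i)" by (rule card_Un_le)
      finally show ?thesis using tight(3) by simp
    qed
    ultimately obtain g where g: "inj_on g (I - J)" "\<forall>i\<in>I - J. g i \<in> B i"
      using less.hyps[of "I - J" B] fin by (auto simp: B_def)
    define h where "h i = (if i \<in> J then f i else g i)" for i
    have "inj_on h I"
    proof (rule inj_onI)
      fix x y assume *: "x \<in> I" "y \<in> I" "h x = h y"
      consider "x \<in> J" "y \<in> J" | "x \<notin> J" "y \<notin> J" | "x \<in> J" "y \<notin> J" | "x \<notin> J" "y \<in> J" by blast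
      then show "x = y"
      proof cases
        case 1
        then show ?thesis using * f(1) by (simp add: h_def inj_on_def)
      next
        case 2
        then show ?thesis using * g(1) by (simp add: h_def inj_on_def)
      next
        case 3
        then show ?thesis using * f(2) g(2) by (auto simp: h_def B_def)
      next
        case 4
        then have "g x \<in> B x" "f y \<in> A y" using * f(2) g(2) by blast+
        then show ?thesis using * 4 by (auto simp: h_def B_def)
      qed
    qed
    moreover have "\<forall>i\<in>I. h i \<in> A i" using f(2) g(2) by (auto simp: h_def B_def)
    ultimately show ?thesis by blast
  next
    case loose
    then obtain i where i: "i \<in> I" by blast
    have "card {i} \<le> card (\<Union>j\<in>{i}. A j)" using i by (intro hall) auto
    then have "A i \<noteq> {}" by auto
    then obtain a where a: "a \<in> A i" by blast
    define B where "B j = A j - {a}" for j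
    have "card (I - {i}) < card I" using i fin(1) by (intro psubset_card_mono) auto
    \<comment> \<open>Removing \<open>a\<close> costs at most one element, which the strict
      inequality for proper subfamilies pays for.\<close>
    moreover have "card K \<le> card (\<Union>j\<in>K. B j)" if "K \<subseteq> I - {i}" for K
    proof (cases "K = {}")
      case False
      have "card K < card (\<Union>j\<in>K. A j)" using that i False by (intro loose(2)) auto
      also have "\<dots> \<le> Suc (card ((\<Union>j\<in>K. A j) - {a}))"
        by (cases "card (\<Union>j\<in>K. A j)") (simp_all add: card_Diff_singleton_if)
      also have "(\<Union>j\<in>K. A j) - {a} = (\<Union>j\<in>K. B j)" by (auto simp: B_def)
      finally show ?thesis by simp
    qed simp
    ultimately obtain g where g: "inj_on g (I - {i})" "\<forall>j\<in>I - {i}. g j \<in> B j"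
      using less.hyps[of "I - {i}" B] fin by (auto simp: B_def)
    have "inj_on (g(i := a)) I"
      using g by (auto simp: inj_on_def B_def)
    moreover have "\<forall>j\<in>I. (g(i := a)) j \<in> A j" using g(2) a by (auto simp: B_def)
    ultimately show ?thesis by blast
  qed auto
qed

definition antichain :: "('a \<Rightarrow> 'a \<Rightarrow> bool) \<Rightarrow> 'a set \<Rightarrow> bool" where
  "antichain W S \<longleftrightarrow> (\<forall>x\<in>S. \<forall>y\<in>S. \<not> W x y)"

definition width_le :: "('a \<Rightarrow> 'a \<Rightarrow> bool) \<Rightarrow> nat \<Rightarrow> 'a set \<Rightarrow> bool" where
  "width_le W j X \<longleftrightarrow> (\<forall>S\<subseteq>X. finite S \<longrightarrow> antichain W S \<longrightarrow> card S \<le> j)"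

text \<open>Antichains of maximal size form a lattice, in which the join consists of the maximal elements
  of the union. Hall's theorem turns the order between an antichain and the join into a labelling.\<close>

lemma antichain_join:
  assumes irr: "\<And>x. \<not> W x x" and tr: "\<And>x y z. W x y \<Longrightarrow> W y z \<Longrightarrow> W x z"
    and width: "width_le W j X"
    and v: "inj_on v {..<j}" "antichain W (v ` {..<j})" "v ` {..<j} \<subseteq> X"
    and Y: "finite Y" "card Y = j" "antichain W Y" "Y \<subseteq> X"
    and x: "x \<in> Y" "\<And>z. z \<in> X \<Longrightarrow> \<not> W x z"
  shows "\<exists>w. inj_on w {..<j} \<and> antichain W (w ` {..<j}) \<and> w ` {..<j} \<subseteq> X \<and> x \<in> w ` {..<j} \<and>
    (\<forall>i<j. v i = w i \<or> W (v i) (w i))"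
proof -
  define V where "V = v ` {..<j}"
  have V: "finite V" "card V = j" "antichain W V" "V \<subseteq> X"
    using v by (auto simp: V_def card_image)
  \<comment> \<open>The maximal elements of the union form the join \<open>Z\<close>, the minimal
    ones the meet \<open>Z'\<close>.\<close>
  define Z where "Z = {z \<in> V \<union> Y. \<forall>y\<in>V \<union> Y. \<not> W z y}"
  define Z' where "Z' = {z \<in> V \<union> Y. \<forall>y\<in>V \<union> Y. \<not> W y z}"
  have Z: "finite Z" "antichain W Z" "Z \<subseteq> X" "x \<in> Z"
    using V Y x by (auto simp: Z_def antichain_def)
  have Z': "finite Z'" "antichain W Z'" "Z' \<subseteq> X"
    using V Y by (auto simp: Z'_def antichain_def)
  have cZ: "card Z \<le> j" and cZ': "card Z' \<le> j"
    using width Z Z' unfolding width_le_def by blast+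
  \<comment> \<open>An element neither maximal nor minimal would be the middle of a three-element
    chain, and two antichains cannot cover such a chain.\<close>
  have un: "V \<union> Y \<subseteq> Z \<union> Z'"
  proof (rule ccontr)
    assume "\<not> V \<union> Y \<subseteq> Z \<union> Z'"
    then obtain z a b where z: "z \<in> V \<union> Y" "a \<in> V \<union> Y" "b \<in> V \<union> Y" "W z a" "W b z"
      unfolding Z_def Z'_def by blast
    have "W b a" using tr z by blast
    then show False using z V(3) Y(3) unfolding antichain_def by blast
  qed
  have int: "V \<inter> Y \<subseteq> Z \<inter> Z'"
  proof
    fix z assume z: "z \<in> V \<inter> Y"
    then have "\<not> W z y \<and> \<not> W y z" if "y \<in> V \<union> Y" for y
      using that V(3) Y(3) unfolding antichain_def by (cases "y \<in> V") auto
    then show "z \<in> Z \<inter> Z'" using z by (auto simp: Z_def Z'_def)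
  qed
  \<comment> \<open>Counted with multiplicity, \<open>Z\<close> and \<open>Z'\<close> have at least
    \<open>2 * j\<close> elements, while each has at most \<open>j\<close>.\<close>
  have "2 * j = card (V \<union> Y) + card (V \<inter> Y)"
    using V Y card_Un_Int[of V Y] by simp
  also have "\<dots> \<le> card (Z \<union> Z') + card (Z \<inter> Z')"
    using Z(1) Z'(1) by (intro add_mono card_mono[OF _ un] card_mono[OF _ int]) simp_all
  also have "\<dots> = card Z + card Z'" using card_Un_Int[OF Z(1) Z'(1)] by simp
  finally have card_Z: "card Z = j" using cZ cZ' by simp
  define A where "A i = {z \<in> Z. v i = z \<or> W (v i) z}" for i
  \<comment> \<open>The elements \<open>v i\<close> with \<open>i\<close> in \<open>J\<close>,
    together with those elements of \<open>Z\<close> that are neither equal to nor above any of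
    them, form an antichain. Bounding its size by \<open>j\<close> gives Hall's condition.\<close>
  have "card J \<le> card (\<Union>i\<in>J. A i)" if J: "J \<subseteq> {..<j}" for J
  proof -
    let ?N = "\<Union>i\<in>J. A i"
    have finJ: "finite J" using J finite_subset by blast
    have vJ: "v ` J \<subseteq> V" using J by (auto simp: V_def)
    have disj: "v ` J \<inter> (Z - ?N) = {}" by (auto simp: A_def)
    have "antichain W (v ` J \<union> (Z - ?N))"
      unfolding antichain_def
    proof (intro ballI)
      fix a b assume ab: "a \<in> v ` J \<union> (Z - ?N)" "b \<in> v ` J \<union> (Z - ?N)"
      show "\<not> W a b"
      proof (cases "a \<in> v ` J")
        case True
        show ?thesis
        proof (cases "b \<in> v ` J")
          case True
          then show ?thesis using \<open>a \<in> v ` J\<close> vJ V(3) unfolding antichain_def by blast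
        next
          case False
          then have "b \<in> Z - ?N" using ab by blast
          then show ?thesis using True by (auto simp: A_def)
        qed
      next
        case False
        then have "a \<in> Z" using ab by blast
        moreover have "b \<in> V \<union> Y" using ab(2) vJ by (auto simp: Z_def)
        ultimately show ?thesis by (auto simp: Z_def)
      qed
    qed
    moreover have "v ` J \<union> (Z - ?N) \<subseteq> X" using vJ V(4) Z(3) by blast
    ultimately have "card (v ` J \<union> (Z - ?N)) \<le> j"
      using width finJ Z(1) unfolding width_le_def by simp
    moreover have "card (v ` J \<union> (Z - ?N)) = card J + card (Z - ?N)"
      using finJ Z(1) disj v(1) J by (simp add: card_Un_disjoint card_image inj_on_subset)
    moreover have "card (Z - ?N) + card ?N = card Z"
    proof -
      have "?N \<subseteq> Z" by (auto simp: A_def)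
      then show ?thesis
        using Z(1) by (simp add: card_Diff_subset card_mono finite_subset)
    qed
    ultimately show ?thesis using card_Z by simp
  qed
  then obtain w where w: "inj_on w {..<j}" "\<forall>i\<in>{..<j}. w i \<in> A i"
    using hall_matching[of "{..<j}" A] Z(1) by (auto simp: A_def)
  have "w ` {..<j} \<subseteq> Z" using w(2) by (auto simp: A_def)
  \<comment> \<open>An injection into a set of the same size is onto, so the labelling reaches
    \<open>x\<close>.\<close>
  moreover from this have "w ` {..<j} = Z"
    using card_Z Z(1) w(1) by (intro card_subset_eq) (auto simp: card_image)
  ultimately show ?thesis using w Z by (intro exI[of _ w]) (auto simp: A_def)
qed

section \<open>On-line partition into chains of the weaker order\<close>

lemma set_encode_less: "A \<subseteq> {..<m} \<Longrightarrow> set_encode A < 2 ^ m"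
proof -
  assume "A \<subseteq> {..<m}"
  then have "set_encode A \<le> (\<Sum>i<m. 2 ^ i)"
    unfolding set_encode_def by (intro sum_mono2) auto
  also have "\<dots> = 2 ^ m - 1" using sum_power2[of m] by (simp add: lessThan_atLeast0)
  also have "\<dots> < 2 ^ m" by simp
  finally show ?thesis .
qed

text \<open>The tuple coded by \<open>c\<close> has \<open>y\<close> as its \<open>i\<close>-th component iff \<open>j * y + i\<close> is in the finite set
  coded by \<open>c\<close>; the default value \<open>c\<close> only serves to make the search total.\<close>

definition component :: "nat \<Rightarrow> nat \<Rightarrow> nat \<Rightarrow> nat" where
  "component j c i = (LEAST y. c \<le> y \<or> j * y + i \<in> set_decode c)"

lemma computable_component:
  assumes "computable F" "computable G"
  shows "computable (\<lambda>e. component j (F e) (G e))"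
  unfolding component_def
  by (rule computable_Least) (auto intro!: computable_intros assms computable_shift[OF assms(1)] computable_shift[OF assms(2)])

text \<open>Division by \<open>j\<close> recovers both component and index from
  \<open>j * y + i\<close>. The bound on the code keeps the search for a new tuple in
  \<open>partition_step\<close> finite.\<close>

lemma tuple_code:
  assumes "\<And>i. i < j \<Longrightarrow> w i < b"
  obtains c where "c < 2 ^ (j * b)" "\<And>i. i < j \<Longrightarrow> component j c i = w i"
proof
  let ?A = "(\<lambda>i. j * w i + i) ` {..<j}"
  have "j * w i + i < j * b" if "i < j" for i
  proof -
    have "j * w i + i < j * Suc (w i)" using that by simp
    also have "\<dots> \<le> j * b" using assms[OF that] by (intro mult_le_mono) auto
    finally show ?thesis .
  qed
  then show "set_encode ?A < 2 ^ (j * b)" by (intro set_encode_less) auto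
  fix i assume i: "i < j"
  have mem: "j * y + i \<in> ?A \<longleftrightarrow> y = w i" for y
  proof
    assume "j * y + i \<in> ?A"
    then obtain i' where i': "i' < j" "j * y + i = j * w i' + i'" by auto
    have "(j * y + i) div j = y" "(j * w i' + i') div j = w i'"
      "(j * y + i) mod j = i" "(j * w i' + i') mod j = i'"
      using i i'(1) by auto
    then show "y = w i" using i'(2) by metis
  qed (use i in auto)
  have "w i \<le> j * w i + i" using i by (cases j) auto
  also have "\<dots> < set_encode ?A" using i by (intro less_set_encode) auto
  finally have "w i < set_encode ?A" .
  then show "component j (set_encode ?A) i = w i"
    unfolding component_def using mem by (intro Least_equality) auto
qed

text \<open>Let the values have \<open>W\<close>-width at most \<open>j = Suc k\<close>. A labelled \<open>W\<close>-antichain of \<open>j\<close> values is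
  maintained whose components only move upwards in \<open>W\<close>; it moves whenever that makes it contain
  the current value. Values never reached in this way have width at most \<open>k\<close>: if \<open>j\<close> of them
  formed an antichain, the last of them would have been reached by joining this antichain with
  the current one, because the current value is \<open>W\<close>-maximal among those seen so far.\<close>

lemma partition_step:
  assumes L: "decidable_order L" and W: "decidable_order W" and WL: "\<And>x y. W x y \<Longrightarrow> L x y"
    and h: "computable2 h" "increasing L h" and width: "\<And>n. width_le W (Suc k) (vals h n)"
  shows "\<exists>G h'. finite G \<and> (\<forall>g\<in>G. computable2 g \<and> increasing W g) \<and>
    computable2 h' \<and> increasing L h' \<and> (\<forall>n. width_le W k (vals h' n)) \<and>
    (\<forall>n. vals h n = (\<Union>g\<in>G. vals g n) \<union> vals h' n)"
proof -
  note Wapp = decidable_order_app[OF W] and happ = computable2_app[OF h(1)]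
  have Wirr: "\<not> W x x" and Wtr: "W x y \<Longrightarrow> W y z \<Longrightarrow> W x z"
    and Lirr: "\<not> L x x" and Ltr: "L x y \<Longrightarrow> L y z \<Longrightarrow> L x z" for x y z
    using L W by (auto simp: decidable_order_def)
  define j where "j = Suc k"
  let ?v = "component j"
  define seen where "seen n t y \<longleftrightarrow> (\<exists>u<t. h n u = Suc y)" for n t y
  define tuple where "tuple n t c \<longleftrightarrow> (\<forall>i<j. seen n t (?v c i)) \<and>
      (\<forall>i<j. \<forall>i'<j. \<not> W (?v c i) (?v c i') \<and> (?v c i = ?v c i' \<longrightarrow> i = i'))" for n t c
  \<comment> \<open>The state \<open>s\<close> is 0 before the first tuple and one more than the
    code of the held tuple afterwards. \<open>Suc t\<close> lets the value of the present stage
    count as seen.\<close>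
  define R where "R n t s c \<longleftrightarrow> tuple n (Suc t) c \<and> (\<exists>i<j. h n t = Suc (?v c i)) \<and>
      (s = 0 \<or> (\<forall>i<j. ?v (s - 1) i = ?v c i \<or> W (?v (s - 1) i) (?v c i)))" for n t s c
  \<comment> \<open>A seen value \<open>y\<close> contributes \<open>Suc y\<close> to this sum and
    is thus smaller than it, so by \<open>tuple_code\<close> every tuple of seen values has some
    code below \<open>bd n t\<close>.\<close>
  define bd :: "nat \<Rightarrow> nat \<Rightarrow> nat" where "bd n t = 2 ^ (j * (\<Sum>u<Suc t. h n u))" for n t
  \<comment> \<open>A result that is not below \<open>bd n t\<close> signals that no admissible
    tuple has a code below that bound.\<close>
  define next_tuple where "next_tuple n t s = (LEAST c. bd n t \<le> c \<or> R n t s c)" for n t s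
  define st where "st n t = rec_nat 0 (\<lambda>t s. if next_tuple n t s < bd n t then Suc (next_tuple n t s) else s) t" for n t
  define acc where "acc n t \<longleftrightarrow> next_tuple n t (st n t) < bd n t" for n t
  define g where "g i n t = (if st n t = 0 then 0 else Suc (?v (st n t - 1) i))" for i n t
  define h' where "h' n t = (if acc n t then 0 else h n t)" for n t

  have c_bd: "computable (\<lambda>e. bd (F e) (T e))" if "computable F" "computable T" for F T
    unfolding bd_def by (intro computable_intros happ that computable_shift[OF that(1)])
  have c_next: "computable (\<lambda>e. next_tuple (F e) (T e) (S e))"
    if "computable F" "computable T" "computable S" for F T S
  proof -
    have ex: "\<exists>c. bd n t \<le> c \<or> R n t s c" for n t s by blast
    have "computable (\<lambda>e. next_tuple (e 0) (e 1) (e 2))"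
      unfolding next_tuple_def
    proof (rule computable_Least[OF _ ex])
      show "decidable (\<lambda>e. bd (e (Suc 0)) (e (Suc 1)) \<le> e 0 \<or> R (e (Suc 0)) (e (Suc 1)) (e (Suc 2)) (e 0))"
        unfolding R_def tuple_def seen_def
        by (intro computable_intros c_bd computable_component happ Wapp)
    qed
    from computable_app3[OF this that] show ?thesis .
  qed
  have c_st: "computable (\<lambda>e. st (F e) (T e))" if "computable F" "computable T" for F T
    unfolding st_def
    by (intro computable_intros c_next c_bd that computable_shift2[OF that(1)])
  have c_g: "computable2 (g i)" for i
    unfolding computable2_def g_def by (intro computable_intros computable_component c_st)
  have c_h': "computable2 h'"
    unfolding computable2_def h'_def acc_def by (intro computable_intros c_next c_bd c_st happ)

  have st_Suc: "st n (Suc t) = (if acc n t then Suc (next_tuple n t (st n t)) else st n t)" for n t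
    by (simp add: st_def acc_def)
  have acc_R: "R n t (st n t) (next_tuple n t (st n t))" if "acc n t" for n t
    using LeastI[of "\<lambda>c. bd n t \<le> c \<or> R n t (st n t) c" "bd n t"] that
    unfolding acc_def next_tuple_def by auto
  have accI: "acc n t" if "c < bd n t" "R n t (st n t) c" for n t c
    using Least_le[of "\<lambda>c. bd n t \<le> c \<or> R n t (st n t) c" c] that
    unfolding acc_def next_tuple_def by auto
  have seen_mono: "seen n t y" if "seen n s y" "s \<le> t" for n s t y
    using that unfolding seen_def by (meson order_less_le_trans)
  have st_tuple: "tuple n t c" if "st n t = Suc c" for n t c
    using that
  proof (induction t)
    case 0
    then show ?case by (simp add: st_def)
  next
    case (Suc t)
    show ?case
    proof (cases "acc n t")
      case True
      then show ?thesis using acc_R[OF True] Suc.prems by (simp add: st_Suc R_def)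
    next
      case False
      then have "tuple n t c" using Suc by (simp add: st_Suc)
      then show ?thesis unfolding tuple_def using seen_mono[of n t _ "Suc t"] by auto
    qed
  qed
  have st_mono: "\<exists>d. st n t = Suc d \<and> (\<forall>i<j. ?v c i = ?v d i \<or> W (?v c i) (?v d i))"
    if "st n s = Suc c" "s \<le> t" for n s t c
    using that(2)
  proof (induction t rule: dec_induct)
    case base
    then show ?case using that(1) by simp
  next
    case (step t)
    then obtain d where d: "st n t = Suc d" "\<forall>i<j. ?v c i = ?v d i \<or> W (?v c i) (?v d i)" by blast
    show ?case
    proof (cases "acc n t")
      case True
      define d' where "d' = next_tuple n t (st n t)"
      have "\<forall>i<j. ?v d i = ?v d' i \<or> W (?v d i) (?v d' i)"
        using acc_R[OF True] d(1) by (simp add: R_def d'_def)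
      then have "\<forall>i<j. ?v c i = ?v d' i \<or> W (?v c i) (?v d' i)"
        using d(2) Wtr by metis
      then show ?thesis using True by (simp add: st_Suc d'_def)
    qed (use d in \<open>simp add: st_Suc\<close>)
  qed
  have vals_g: "vals (g i) n \<subseteq> vals h n" if "i < j" for i n
  proof
    fix y assume "y \<in> vals (g i) n"
    then obtain t where "g i n t = Suc y" by (auto simp: vals_def)
    then obtain c where "st n t = Suc c" "y = ?v c i"
      by (cases "st n t") (auto simp: g_def)
    then have "seen n t y" using st_tuple that by (simp add: tuple_def)
    then show "y \<in> vals h n" by (auto simp: seen_def vals_def)
  qed
  have vals_h: "vals h n = (\<Union>i<j. vals (g i) n) \<union> vals h' n" for n
  proof
    have "vals h' n \<subseteq> vals h n" by (auto simp: vals_def h'_def split: if_splits)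
    then show "(\<Union>i<j. vals (g i) n) \<union> vals h' n \<subseteq> vals h n" using vals_g by blast
    show "vals h n \<subseteq> (\<Union>i<j. vals (g i) n) \<union> vals h' n"
    proof
      fix x assume "x \<in> vals h n"
      then obtain t where t: "h n t = Suc x" by (auto simp: vals_def)
      show "x \<in> (\<Union>i<j. vals (g i) n) \<union> vals h' n"
      proof (cases "acc n t")
        case True
        then obtain i where "i < j" "x = ?v (next_tuple n t (st n t)) i"
          using acc_R[OF True] t by (auto simp: R_def)
        moreover from this have "g i n (Suc t) = Suc x" using True by (simp add: g_def st_Suc)
        ultimately show ?thesis by (auto simp: vals_def)
      next
        case False
        then have "h' n t = Suc x" using t by (simp add: h'_def)
        then show ?thesis by (auto simp: vals_def)
      qed
    qed
  qed
  have width': "width_le W k (vals h' n)" for n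
    unfolding width_le_def
  proof (intro allI impI, rule ccontr)
    fix S assume S: "S \<subseteq> vals h' n" "finite S" "antichain W S" "\<not> card S \<le> k"
    have "S \<subseteq> vals h n" using S(1) vals_h by blast
    then have cS: "card S = j"
      using width[of n] S unfolding width_le_def j_def by (metis le_SucE)
    have "\<forall>y\<in>S. \<exists>t. h' n t = Suc y" using S(1) by (auto simp: vals_def)
    then obtain T where T: "\<And>y. y \<in> S \<Longrightarrow> h' n (T y) = Suc y" by metis
    have "S \<noteq> {}" using cS by (auto simp: j_def)
    then have "Max (T ` S) \<in> T ` S" using S(2) by (intro Max_in) auto
    then obtain x where x: "x \<in> S" "T x = Max (T ` S)" by auto
    \<comment> \<open>At this latest of the chosen stages all of \<open>S\<close> has been seen, and
      nothing seen so far is \<open>W\<close>-above \<open>x\<close>.\<close>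
    define t where "t = T x"
    have T_le: "T y \<le> t" if "y \<in> S" for y
      using that S(2) x(2) by (simp add: t_def)
    have h't: "h' n t = Suc x" using T x(1) by (simp add: t_def)
    then have nacc: "\<not> acc n t" and ht: "h n t = Suc x" by (auto simp: h'_def split: if_splits)
    define X where "X = {y. seen n (Suc t) y}"
    have SX: "S \<subseteq> X"
    proof
      fix y assume "y \<in> S"
      then have "h n (T y) = Suc y" using T[of y] by (auto simp: h'_def split: if_splits)
      then show "y \<in> X"
        using T_le[OF \<open>y \<in> S\<close>] unfolding X_def seen_def by (auto intro!: exI[of _ "T y"])
    qed
    have "X \<subseteq> vals h n" by (auto simp: X_def seen_def vals_def)
    then have wX: "width_le W j X" using width[of n] unfolding width_le_def j_def by blast
    have x_max: "\<not> W x z" if z: "z \<in> X" for z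
    proof -
      obtain u where "u \<le> t" "h n u = Suc z" using z by (auto simp: X_def seen_def less_Suc_eq_le)
      then have "z = x \<or> L z x" using h(2) ht unfolding increasing_def by blast
      then show ?thesis using WL Lirr Ltr by blast
    qed
    \<comment> \<open>Without a held tuple \<open>S\<close> itself is taken, otherwise its join with
      the held tuple. Either way a tuple containing \<open>x\<close> was admissible, contradicting
      that \<open>x\<close> was passed on to \<open>h'\<close>.\<close>
    have "\<exists>w. inj_on w {..<j} \<and> antichain W (w ` {..<j}) \<and> w ` {..<j} \<subseteq> X \<and> x \<in> w ` {..<j} \<and>
        (st n t = 0 \<or> (\<forall>i<j. ?v (st n t - 1) i = w i \<or> W (?v (st n t - 1) i) (w i)))"
    proof (cases "st n t")
      case 0
      obtain w where "bij_betw w {0..<j} S" using ex_bij_betw_nat_finite[OF S(2)] cS by auto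
      then have "inj_on w {..<j}" "w ` {..<j} = S" by (auto simp: bij_betw_def lessThan_atLeast0)
      then show ?thesis using 0 S(3) SX x(1) by auto
    next
      case (Suc c)
      have c: "tuple n t c" using st_tuple[OF Suc] .
      have "\<exists>w. inj_on w {..<j} \<and> antichain W (w ` {..<j}) \<and> w ` {..<j} \<subseteq> X \<and> x \<in> w ` {..<j} \<and>
          (\<forall>i<j. ?v c i = w i \<or> W (?v c i) (w i))"
      proof (rule antichain_join[OF _ _ wX])
        show "inj_on (?v c) {..<j}" "antichain W (?v c ` {..<j})"
          using c by (auto simp: tuple_def inj_on_def antichain_def)
        show "?v c ` {..<j} \<subseteq> X"
          using c seen_mono[of n t _ "Suc t"] by (auto simp: tuple_def X_def)
      qed (use Wirr Wtr S(2,3) cS SX x(1) x_max in auto)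
      then show ?thesis using Suc by simp
    qed
    then obtain w where w: "inj_on w {..<j}" "antichain W (w ` {..<j})" "w ` {..<j} \<subseteq> X" "x \<in> w ` {..<j}"
      "st n t = 0 \<or> (\<forall>i<j. ?v (st n t - 1) i = w i \<or> W (?v (st n t - 1) i) (w i))" by blast
    have w_less: "w i < (\<Sum>u<Suc t. h n u)" if i: "i < j" for i
    proof -
      obtain u where u: "u < Suc t" "h n u = Suc (w i)" using w(3) i by (auto simp: X_def seen_def)
      have "h n u \<le> (\<Sum>u<Suc t. h n u)" using u(1) by (intro member_le_sum) auto
      then show ?thesis using u(2) by simp
    qed
    obtain c where c: "c < bd n t" "\<And>i. i < j \<Longrightarrow> ?v c i = w i"
      unfolding bd_def by (rule tuple_code[of j w, OF w_less]) blast+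
    have "tuple n (Suc t) c"
      using w(1-3) c(2) by (auto simp: tuple_def X_def antichain_def inj_on_def)
    moreover have "\<exists>i<j. h n t = Suc (?v c i)" using w(4) c(2) ht by auto
    ultimately have "R n t (st n t) c" using w(5) c(2) by (auto simp: R_def)
    then show False using accI[OF c(1)] nacc by blast
  qed
  show ?thesis
  proof (intro exI[of _ "g ` {..<j}"] exI[of _ h'] conjI ballI allI)
    fix f assume "f \<in> g ` {..<j}"
    then obtain i where i: "i < j" "f = g i" by auto
    have "increasing W (g i)"
      unfolding increasing_def
    proof (intro allI impI)
      fix n s t x y assume *: "s \<le> t" "g i n s = Suc x" "g i n t = Suc y"
      obtain c where c: "st n s = Suc c" "x = ?v c i" using *(2) by (cases "st n s") (auto simp: g_def)
      obtain d where "st n t = Suc d" "?v c i = ?v d i \<or> W (?v c i) (?v d i)"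
        using st_mono[OF c(1) *(1)] i(1) by blast
      then show "x = y \<or> W x y" using c *(3) by (simp add: g_def)
    qed
    then show "computable2 f" "increasing W f" using c_g i by simp_all
  next
    show "increasing L h'"
      using h(2) unfolding increasing_def h'_def by (metis nat.distinct(1))
    show "vals h n = (\<Union>g\<in>g ` {..<j}. vals g n) \<union> vals h' n" for n
      using vals_h by simp
  qed (use c_h' width' in auto)
qed

text \<open>Each \<open>partition_step\<close> lowers the width of the remainder by one. At width 0
  nothing is left, since singletons are antichains.\<close>

lemma chain_partition:
  assumes L: "decidable_order L" and W: "decidable_order W" and WL: "\<And>x y. W x y \<Longrightarrow> L x y"
  shows "computable2 h \<Longrightarrow> increasing L h \<Longrightarrow> (\<And>n. width_le W k (vals h n)) \<Longrightarrow>
    \<exists>G. finite G \<and> (\<forall>g\<in>G. computable2 g \<and> increasing W g) \<and> (\<forall>n. vals h n = (\<Union>g\<in>G. vals g n))"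
proof (induction k arbitrary: h)
  case 0
  have "vals h n = {}" for n
  proof -
    have "x \<notin> vals h n" for x
    proof
      assume "x \<in> vals h n"
      moreover have "antichain W {x}" using W by (auto simp: antichain_def decidable_order_def)
      ultimately have "card {x} \<le> 0" using 0(3)[of n] unfolding width_le_def by blast
      then show False by simp
    qed
    then show ?thesis by blast
  qed
  then show ?case by (intro exI[of _ "{}"]) auto
next
  case (Suc k)
  obtain G h' where G: "finite G" "\<forall>g\<in>G. computable2 g \<and> increasing W g"
    and h': "computable2 h'" "increasing L h'" "\<And>n. width_le W k (vals h' n)"
    and vals: "\<And>n. vals h n = (\<Union>g\<in>G. vals g n) \<union> vals h' n"
    using partition_step[OF L W WL Suc.prems] by blast
  obtain G' where "finite G'" "\<forall>g\<in>G'. computable2 g \<and> increasing W g" "\<forall>n. vals h' n = (\<Union>g\<in>G'. vals g n)"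
    using Suc.IH[OF h'] by blast
  then show ?case using G vals by (intro exI[of _ "G \<union> G'"]) auto
qed

section \<open>Comparison of the complexities\<close>

lemma unbounded_chain_antichain_code:
  assumes bij: "bij rho" and star: "cond_star lst lwk"
  shows "unbounded_chain_antichain (code_order rho lst) (code_order rho lwk)"
  unfolding unbounded_chain_antichain_def
proof
  fix k
  obtain S where S: "finite S" "card S = k" "\<forall>x\<in>S. \<forall>y\<in>S. x \<noteq> y \<longrightarrow> lst x y \<or> lst y x"
    "\<forall>x\<in>S. \<forall>y\<in>S. \<not> lwk x y"
    using spec[OF star[unfolded cond_star_def], of k] by (elim exE conjE)
  have id: "rho (inv rho x) = x" for x
    by (rule surj_f_inv_f[OF bij_is_surj[OF bij]])
  have inj: "inj_on (inv rho) S"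
    using id by (rule inj_on_inverseI)
  show "\<exists>S. finite S \<and> card S = k \<and> chain_antichain (code_order rho lst) (code_order rho lwk) S"
  proof (intro exI conjI)
    show "finite (inv rho ` S)" "card (inv rho ` S) = k" using S(1,2) inj by (simp_all add: card_image)
    show "chain_antichain (code_order rho lst) (code_order rho lwk) (inv rho ` S)"
      unfolding chain_antichain_def code_order_def using S(3,4) id by (metis imageE)
  qed
qed

text \<open>The least element comes first and the rest follows recursively; a one-element chain is
  listed by a constant function, so the last value repeats forever.\<close>

lemma chain_listing:
  assumes L: "\<And>x. \<not> L x x" "\<And>x y z. L x y \<Longrightarrow> L y z \<Longrightarrow> L x z"
    and S: "finite S" "S \<noteq> {}" "\<And>x y. x \<in> S \<Longrightarrow> y \<in> S \<Longrightarrow> x \<noteq> y \<Longrightarrow> L x y \<or> L y x"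
  shows "\<exists>q. computable (\<lambda>e. q (e 0)) \<and> range q = S \<and> (\<forall>s t. s \<le> t \<longrightarrow> q s = q t \<or> L (q s) (q t))"
  using S
proof (induction S rule: finite_psubset_induct)
  case (psubset S)
  have "\<exists>m\<in>S. \<forall>y\<in>S. y = m \<or> L m y"
    by (rule obtain_least_in_chain) (use L psubset.hyps psubset.prems in blast)+
  then obtain m where m: "m \<in> S" "\<And>y. y \<in> S \<Longrightarrow> y = m \<or> L m y" by blast
  show ?case
  proof (cases "S = {m}")
    case True
    then show ?thesis by (intro exI[of _ "\<lambda>_. m"]) (auto intro: computable_const)
  next
    case False
    have "\<exists>q. computable (\<lambda>e. q (e 0)) \<and> range q = S - {m} \<and> (\<forall>s t. s \<le> t \<longrightarrow> q s = q t \<or> L (q s) (q t))"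
      using m False psubset.prems by (intro psubset.IH) auto
    then obtain q where q: "computable (\<lambda>e. q (e 0))" "range q = S - {m}"
      "\<And>s t. s \<le> t \<Longrightarrow> q s = q t \<or> L (q s) (q t)" by blast
    define p where "p t = (if t = 0 then m else q (t - 1))" for t
    have p: "p 0 = m" "p (Suc t) = q t" for t by (simp_all add: p_def)
    have "computable (\<lambda>e. p (e 0))"
      unfolding p_def by (intro computable_intros computable_app1[OF q(1)])
    moreover have "range p = S"
    proof -
      have "range p = p ` insert 0 (range Suc)" by (metis UNIV_eq_I insertCI not0_implies_Suc rangeI)
      also have "\<dots> = insert m (range q)" by (simp add: p image_image)
      finally show ?thesis using q(2) m(1) by auto
    qed
    moreover have "p s = p t \<or> L (p s) (p t)" if "s \<le> t" for s t
    proof (cases "s = 0")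
      case True
      have "p t \<in> S" using \<open>range p = S\<close> by blast
      then show ?thesis using m(2)[of "p t"] True by (auto simp: p_def)
    next
      case False
      then show ?thesis using that q(3)[of "s - 1" "t - 1"] by (auto simp: p_def)
    qed
    ultimately show ?thesis by blast
  qed
qed

text \<open>The increasing listing of a chain is an admissible \<open>f\<close> in
  \<open>cond_2star\<close>. Each of the \<open>k\<close> parts is \<open>lwk\<close>-increasing and
  shows at most one element of an antichain, so the parts cannot cover \<open>k + 1\<close>
  elements.\<close>

lemma bounded_chain_antichain:
  assumes Pst: "comp_poset lst rho"
    and split: "cond_2star lst lwk rho"
  shows "\<not> unbounded_chain_antichain (code_order rho lst) (code_order rho lwk)"
proof
  let ?L = "code_order rho lst" and ?W = "code_order rho lwk"
  assume unb: "unbounded_chain_antichain ?L ?W"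
  have inj: "inj rho" using Pst by (simp add: comp_poset_def bij_is_inj)
  have L: "\<not> ?L x x" "?L x y \<Longrightarrow> ?L y z \<Longrightarrow> ?L x z" for x y z
    using comp_poset_decidable_order[OF Pst] unfolding decidable_order_def by blast+
  obtain k where k: "\<And>f. comp_fn rho f \<Longrightarrow> mono2 lst f \<Longrightarrow> \<exists>fs :: nat \<Rightarrow> bool list \<Rightarrow> nat \<Rightarrow> 'a option.
      (\<forall>i\<in>{1..k}. comp_fn rho (fs i) \<and> mono2 lwk (fs i)) \<and>
      (\<forall>p. values_of f p = (\<Union>i\<in>{1..k}. values_of (fs i) p))"
    using split unfolding cond_2star_def by blast
  obtain S where S: "finite S" "card S = Suc k" "chain_antichain ?L ?W S"
    using unb unfolding unbounded_chain_antichain_def by blast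
  have "S \<noteq> {}" using S(2) by auto
  then obtain q where q: "computable (\<lambda>e. q (e 0))" "range q = S"
    "\<And>s t. s \<le> t \<Longrightarrow> q s = q t \<or> ?L (q s) (q t)"
    using chain_listing[of ?L S] L S unfolding chain_antichain_def by blast
  define f :: "bool list \<Rightarrow> nat \<Rightarrow> 'a option" where "f p t = Some (rho (q t))" for p t
  have "computable2 (\<lambda>n t. Suc (q t))"
    unfolding computable2_def by (intro computable_intros computable_app1[OF q(1)])
  from pcomp2_of_computable2[OF this] have "comp_fn rho f"
    using inj by (simp add: comp_fn_def f_def)
  moreover have "mono2 lst f"
    using q(3) unfolding mono2_def f_def code_order_def by (metis option.inject)
  ultimately obtain fs where fs: "\<forall>i\<in>{1..k}. comp_fn rho (fs i) \<and> mono2 lwk (fs i)"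
    "\<forall>p. values_of f p = (\<Union>i\<in>{1..k}. values_of (fs i) p)"
    by (elim k[THEN exE]) blast+
  have vf: "values_of f [] = rho ` S" using q(2) by (auto simp: values_of_def f_def)
  have one: "card (values_of (fs i) []) \<le> 1" if i: "i \<in> {1..k}" for i
  proof -
    have sub: "values_of (fs i) [] \<subseteq> rho ` S" using fs(2) vf i by blast
    have "x = y" if xy: "x \<in> values_of (fs i) []" "y \<in> values_of (fs i) []" for x y
    proof -
      obtain s t where st: "fs i [] s = Some x" "fs i [] t = Some y" using xy unfolding values_of_def by blast
      have "x = y \<or> lwk x y \<or> lwk y x"
        using fs(1) i st nat_le_linear[of s t] unfolding mono2_def by metis
      moreover have anti: "\<forall>a\<in>S. \<forall>b\<in>S. \<not> lwk (rho a) (rho b)"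
        using S(3) by (simp add: chain_antichain_def code_order_def)
      have "x \<in> rho ` S" "y \<in> rho ` S" using xy sub by (simp_all only: subsetD)
      then obtain a b where "a \<in> S" "b \<in> S" "x = rho a" "y = rho b" by (elim imageE)
      then have "\<not> lwk x y" "\<not> lwk y x" using anti by simp_all
      ultimately show ?thesis by blast
    qed
    moreover have "finite (values_of (fs i) [])" using sub S(1) finite_subset by blast
    ultimately show ?thesis by (simp add: card_le_Suc0_iff_eq)
  qed
  have "Suc k = card (\<Union>i\<in>{1..k}. values_of (fs i) [])"
    using fs(2) vf S(2) inj by (metis card_image inj_on_subset subset_UNIV)
  also have "\<dots> \<le> (\<Sum>i\<in>{1..k}. card (values_of (fs i) []))" by (rule card_UN_le) simp
  also have "\<dots> \<le> (\<Sum>i\<in>{1..k}. 1)" using one by (intro sum_mono) auto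
  finally show False by simp
qed

lemma le_ct_of_codes:
  assumes "bij rho" "\<And>m. KU U (rho m) \<le> KU V (rho m) + c"
  shows "le_ct (KU U) (KU V)"
  unfolding le_ct_def using assms by (metis bij_pointE)

text \<open>An enumeration increasing for \<open>lwk\<close> is increasing for \<open>lst\<close>
  with the same maximum, so the same inputs serve for the stronger order.\<close>

lemma KU_stronger_le:
  assumes Pst: "comp_poset lst rho" and Pwk: "comp_poset lwk rho"
    and ext: "\<And>x y. lwk x y \<Longrightarrow> lst x y"
    and U: "optimal_max lst rho U" and V: "optimal_max lwk rho V"
  shows "le_ct (KU U) (KU V)"
proof -
  let ?L = "code_order rho lst" and ?W = "code_order rho lwk"
  obtain h where h: "computable2 h" "increasing ?W h"
    "\<And>m. \<exists>n. length (bl_of_nat n) = KU V (rho m) \<and> finite (vals h n) \<and> is_max ?W (vals h n) m"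
    using optimal_max_attained[OF Pwk V] by metis
  have "increasing ?L h"
    using h(2) ext unfolding increasing_def code_order_def by blast
  then obtain c where c: "\<And>n m. finite (vals h n) \<Longrightarrow> is_max ?L (vals h n) m \<Longrightarrow>
      KU U (rho m) \<le> length (bl_of_nat n) + c"
    using optimal_max_le[OF Pst U h(1)] by blast
  have "KU U (rho m) \<le> KU V (rho m) + c" for m
  proof -
    obtain n where n: "length (bl_of_nat n) = KU V (rho m)" "finite (vals h n)" "is_max ?W (vals h n) m"
      using h(3) by blast
    have "is_max ?L (vals h n) m" using n(3) ext by (auto simp: is_max_def code_order_def)
    then show ?thesis using c[OF n(2)] n(1) by metis
  qed
  then show ?thesis using Pst by (intro le_ct_of_codes[of rho]) (auto simp: comp_poset_def)
qed

text \<open>The maximum of an \<open>lst\<close>-increasing enumeration is listed, on the same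
  input, by one of finitely many \<open>lwk\<close>-increasing ones, and it is the maximum there
  too. Summing the constants of all pieces gives a uniform one.\<close>

lemma KU_weaker_le:
  assumes Pst: "comp_poset lst rho" and Pwk: "comp_poset lwk rho"
    and ext: "\<And>x y. lwk x y \<Longrightarrow> lst x y"
    and bounded: "\<not> unbounded_chain_antichain (code_order rho lst) (code_order rho lwk)"
    and U: "optimal_max lst rho U" and V: "optimal_max lwk rho V"
  shows "le_ct (KU V) (KU U)"
proof -
  let ?L = "code_order rho lst" and ?W = "code_order rho lwk"
  note Ld = comp_poset_decidable_order[OF Pst] and Wd = comp_poset_decidable_order[OF Pwk]
  have WL: "?L x y" if "?W x y" for x y using ext that by (simp add: code_order_def)
  obtain k where k: "\<And>S. finite S \<Longrightarrow> chain_antichain ?L ?W S \<Longrightarrow> card S \<noteq> k"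
    using bounded unfolding unbounded_chain_antichain_def by blast
  obtain h where h: "computable2 h" "increasing ?L h"
    "\<And>m. \<exists>n. length (bl_of_nat n) = KU U (rho m) \<and> finite (vals h n) \<and> is_max ?L (vals h n) m"
    using optimal_max_attained[OF Pst U] by metis
  \<comment> \<open>A larger antichain would contain one with exactly \<open>k\<close> elements, and
    the values of \<open>h\<close> on one input form a chain of the stronger order.\<close>
  have width: "width_le ?W k (vals h n)" for n
    unfolding width_le_def
  proof (intro allI impI, rule ccontr)
    fix S assume S: "S \<subseteq> vals h n" "finite S" "antichain ?W S" "\<not> card S \<le> k"
    then obtain T where T: "T \<subseteq> S" "card T = k" "finite T"
      using obtain_subset_with_card_n[of k S] by auto
    have "chain_antichain ?L ?W T"
      using T(1) S(1,3) increasing_vals_chain[OF h(2)]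
      unfolding chain_antichain_def antichain_def by (meson subsetD)
    then show False using k T by blast
  qed
  have "\<exists>G. finite G \<and> (\<forall>g\<in>G. computable2 g \<and> increasing ?W g) \<and> (\<forall>n. vals h n = (\<Union>g\<in>G. vals g n))"
    using WL h(1,2) width by (rule chain_partition[OF Ld Wd])
  then obtain G where G: "finite G" "\<forall>g\<in>G. computable2 g \<and> increasing ?W g"
    "\<forall>n. vals h n = (\<Union>g\<in>G. vals g n)" by blast
  have "\<forall>g\<in>G. \<exists>c. \<forall>n m. finite (vals g n) \<and> is_max ?W (vals g n) m \<longrightarrow> KU V (rho m) \<le> length (bl_of_nat n) + c"
  proof
    fix g assume "g \<in> G"
    then show "\<exists>c. \<forall>n m. finite (vals g n) \<and> is_max ?W (vals g n) m \<longrightarrow> KU V (rho m) \<le> length (bl_of_nat n) + c"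
      using optimal_max_le[OF Pwk V, of g] G(2) by blast
  qed
  from bchoice[OF this] obtain c where c: "\<And>g n m. g \<in> G \<Longrightarrow> finite (vals g n) \<Longrightarrow>
      is_max ?W (vals g n) m \<Longrightarrow> KU V (rho m) \<le> length (bl_of_nat n) + c g"
    by blast
  have "KU V (rho m) \<le> KU U (rho m) + (\<Sum>g\<in>G. c g)" for m
  proof -
    obtain n where n: "length (bl_of_nat n) = KU U (rho m)" "finite (vals h n)" "is_max ?L (vals h n) m"
      using h(3) by blast
    then obtain g where g: "g \<in> G" "m \<in> vals g n" using G(3) by (auto simp: is_max_def)
    have sub: "vals g n \<subseteq> vals h n" using G(3) g(1) by blast
    have "is_max ?W (vals g n) m"
      unfolding is_max_def
    proof (intro conjI ballI g(2))
      fix x assume x: "x \<in> vals g n"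
      have "x = m \<or> ?W x m \<or> ?W m x"
        using increasing_vals_chain[of ?W g x n m] G(2) g x by blast
      moreover have "\<not> ?W m x"
      proof
        assume "?W m x"
        moreover have "x = m \<or> ?L x m" using n(3) x sub unfolding is_max_def by blast
        ultimately have "?L m m" using WL Ld unfolding decidable_order_def by metis
        then show False using Ld unfolding decidable_order_def by blast
      qed
      ultimately show "x = m \<or> ?W x m" by blast
    qed
    then have "KU V (rho m) \<le> length (bl_of_nat n) + c g"
      using c g(1) finite_subset[OF sub n(2)] by blast
    moreover have "c g \<le> (\<Sum>g\<in>G. c g)" using G(1) g(1) by (intro member_le_sum) auto
    ultimately show ?thesis using n(1) by simp
  qed
  then show ?thesis using Pst by (intro le_ct_of_codes[of rho]) (auto simp: comp_poset_def)
qed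

section \<open>Passage to the reversed orders\<close>

lemma conv_ord_conv_ord [simp]: "conv_ord (conv_ord lt) = lt"
  by (simp add: conv_ord_def fun_eq_iff)

lemma cond_star_conv_ord: "cond_star lst lwk \<Longrightarrow> cond_star (conv_ord lst) (conv_ord lwk)"
  unfolding cond_star_def conv_ord_def by meson

text \<open>Through this symmetry the bound obtained from \<open>cond_2star\<close> also serves for
  the minimum complexities.\<close>

lemma unbounded_chain_antichain_conv_ord:
  "unbounded_chain_antichain (code_order rho (conv_ord lst)) (code_order rho (conv_ord lwk)) \<longleftrightarrow>
   unbounded_chain_antichain (code_order rho lst) (code_order rho lwk)"
proof -
  have "chain_antichain (code_order rho (conv_ord lst)) (code_order rho (conv_ord lwk)) S \<longleftrightarrow>
    chain_antichain (code_order rho lst) (code_order rho lwk) S" for S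
    unfolding chain_antichain_def code_order_def conv_ord_def by blast
  then show ?thesis by (simp add: unbounded_chain_antichain_def)
qed

lemma total_computable1_add: "total_computable1 (\<lambda>x. x + c)"
proof -
  have "\<forall>x y. eval (((Cn Sc \<circ> (\<lambda>r. [r])) ^^ c) (Proj 0)) [x] y \<longleftrightarrow> y = x + c"
  proof (induction c)
    case (Suc c)
    then show ?case by (auto simp: eval_Cn_iff list_all2_Cons1 eval_Sc_iff)
  qed (simp add: eval_Proj_iff)
  then show ?thesis unfolding total_computable1_def pcomp1_def by (auto simp: eq_commute)
qed

text \<open>The function adding \<open>Suc c\<close> refutes the constant \<open>c\<close>.\<close>

lemma not_le_ct_of_infinite:
  assumes "\<And>a. total_computable1 a \<Longrightarrow> infinite {d. a (KU U d) \<le> KU V1 d \<and> a (KU U d) \<le> KU V2 d}"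
  shows "\<not> le_ct (KU V1) (KU U)"
proof
  assume "le_ct (KU V1) (KU U)"
  then obtain c where c: "\<And>d. KU V1 d \<le> KU U d + c" by (auto simp: le_ct_def)
  have "infinite {d. KU U d + Suc c \<le> KU V1 d \<and> KU U d + Suc c \<le> KU V2 d}"
    using assms[OF total_computable1_add[of "Suc c"]] .
  then obtain d where "KU U d + Suc c \<le> KU V1 d" using not_finite_existsD by blast
  then show False using c[of d] by simp
qed

theorem mainTheorem3:
  fixes lst lwk :: "'d \<Rightarrow> 'd \<Rightarrow> bool" and rho :: "nat \<Rightarrow> 'd"
    and Ust_max Ust_min Uwk_max Uwk_min :: "bool list \<Rightarrow> 'd option"
  assumes "comp_poset lst rho" and "comp_poset lwk rho"
    and "\<forall>d e. lwk d e \<longrightarrow> lst d e"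
    and "optimal_max lst rho Ust_max" and "optimal_max (conv_ord lst) rho Ust_min"
    and "optimal_max lwk rho Uwk_max" and "optimal_max (conv_ord lwk) rho Uwk_min"
  shows "(cond_star lst lwk \<longrightarrow>
            lt_ct (KU Ust_max) (KU Uwk_max) \<and> lt_ct (KU Ust_min) (KU Uwk_min) \<and>
            (\<forall>\<alpha>. total_computable1 \<alpha> \<longrightarrow>
               infinite {d. min (KU Uwk_min d) (KU Uwk_max d) \<ge> \<alpha> (KU Ust_max d)} \<and>
               infinite {d. min (KU Uwk_min d) (KU Uwk_max d) \<ge> \<alpha> (KU Ust_min d)}))
       \<and> (cond_2star lst lwk rho \<longrightarrow>
            eq_ct (KU Ust_min) (KU Uwk_min) \<and> eq_ct (KU Ust_max) (KU Uwk_max))"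
proof (intro conjI impI)
  let ?cst = "conv_ord lst" and ?cwk = "conv_ord lwk"
  have Pcst: "comp_poset ?cst rho" and Pcwk: "comp_poset ?cwk rho"
    using assms(1,2) by (auto intro: comp_poset_conv_ord)
  have bij: "bij rho" using assms(1) by (simp add: comp_poset_def)
  have ext: "lwk x y \<Longrightarrow> lst x y" and cext: "?cwk x y \<Longrightarrow> ?cst x y" for x y
    using assms(3) by (auto simp: conv_ord_def)
  have le_max: "le_ct (KU Ust_max) (KU Uwk_max)"
    by (rule KU_stronger_le[OF assms(1,2) ext assms(4,6)])
  have le_min: "le_ct (KU Ust_min) (KU Uwk_min)"
    by (rule KU_stronger_le[OF Pcst Pcwk cext assms(5,7)])
  {
    assume star: "cond_star lst lwk"
    note unb = unbounded_chain_antichain_code[OF bij star]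
      and cunb = unbounded_chain_antichain_code[OF bij cond_star_conv_ord[OF star]]
    \<comment> \<open>Reversing twice restores the order, so in the second application the two weak
      functions exchange roles.\<close>
    have V: "optimal_max (conv_ord ?cwk) rho Uwk_max" using assms(6) by simp
    note inf_max = infinitely_many_large[OF assms(1,2) unb assms(4,6,7)]
      and inf_min = infinitely_many_large[OF Pcst Pcwk cunb assms(5,7) V]
    show "lt_ct (KU Ust_max) (KU Uwk_max)"
      using le_max not_le_ct_of_infinite[OF inf_max] by (simp add: lt_ct_def)
    show "lt_ct (KU Ust_min) (KU Uwk_min)"
      using le_min not_le_ct_of_infinite[OF inf_min] by (simp add: lt_ct_def)
    show "\<forall>\<alpha>. total_computable1 \<alpha> \<longrightarrow>
               infinite {d. min (KU Uwk_min d) (KU Uwk_max d) \<ge> \<alpha> (KU Ust_max d)} \<and>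
               infinite {d. min (KU Uwk_min d) (KU Uwk_max d) \<ge> \<alpha> (KU Ust_min d)}"
      using inf_max inf_min by (simp add: conj_commute)
  }
  {
    assume "cond_2star lst lwk rho"
    then have bd: "\<not> unbounded_chain_antichain (code_order rho lst) (code_order rho lwk)"
      by (rule bounded_chain_antichain[OF assms(1)])
    then have cbd: "\<not> unbounded_chain_antichain (code_order rho ?cst) (code_order rho ?cwk)"
      by (simp add: unbounded_chain_antichain_conv_ord)
    show "eq_ct (KU Ust_min) (KU Uwk_min)"
      using le_min KU_weaker_le[OF Pcst Pcwk cext cbd assms(5,7)] by (simp add: eq_ct_def)
    show "eq_ct (KU Ust_max) (KU Uwk_max)"
      using le_max KU_weaker_le[OF assms(1,2) ext bd assms(4,6)] by (simp add: eq_ct_def)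
  }
qed

end
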